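(* For every integer $n\ge 2$, the following ladder equations hold (as identities of rational functions of $x$): $$F_{4,n}(x)S_{n}(x)+G_{4,n}(x)S_{n}'(x)=S_{n-1}(x),\qquad V_{4,n}(x)S_{n-1}(x)+W_{4,n}(x)S_{n-1}'(x)=S_{n}(x),$$ where $$F_{4,n}=\frac{q_{2,n}}{q_{1,n}},\quad G_{4,n}=\frac{q_{0,n}}{q_{1,n}},\quad V_{4,n}=\frac{q_{3,n}}{q_{4,n}},\quad W_{4,n}=\frac{q_{0,n}}{q_{4,n}},$$ and $q_{0,n},\dots,q_{4,n}$ are the polynomials below, with the indicated degrees and leading coefficients: \begin{align*} q_{0,n}(x)&=x\Delta_n(x), & \mathrm{DgCo}(q_{0,n})&=\left(2d+1,\,1+\tfrac{\sigma_{n-1}}{\gamma_{n-1}}\right),\\ q_{1,n}(x)&=G_{3,n}(x)F_{2,n}(x)-F_{3,n}(x)G_{2,n}(x), & \mathrm{DgCo}(q_{1,n})&=(2d,\,\gamma_n+\sigma_n),\\ q_{2,n}(x)&=x\rho'(x)\delta_n(x)+G_{3,n}(x)V_{2,n}(x)-F_{3,n}(x)W_{2,n}(x), & \mathrm{DgCo}(q_{2,n})&=\left(2d,\,-n\left[1+\tfrac{\sigma_{n-1}}{\gamma_{n-1}}\right]\right),\\ q_{3,n}(x)&=x\rho'(x)\delta_n(x)+V_{3,n}(x)G_{2,n}(x)-W_{3,n}(x)F_{2,n}(x), & \mathrm{DgCo}(q_{3,n})&=\left(2d+1,\,-\left[1+\tfrac{\sigma_{n-1}}{\gamma_{n-1}}\right]\right),\\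 q_{4,n}(x)&=V_{3,n}(x)W_{2,n}(x)-W_{3,n}(x)V_{2,n}(x), & \mathrm{DgCo}(q_{4,n})&=\left(2d,\,-\left[1+\tfrac{\sigma_{n-1}}{\gamma_{n-1}}\right]\right). \end{align*}
   Context: Setting. Let $\alpha>-1$, $N\ge 1$, let $c_1,\dots,c_N\in(-\infty,0)$ be distinct, let $0\le d_1\le\cdots\le d_N$ be integers, and let $\lambda_{j,k}\ge 0$ for $1\le j\le N$, $0\le k\le d_j$, with $\lambda_{j,d_j}>0$ for every $j$. Put $I_+=\{(j,k):\lambda_{j,k}>0\}$. On real polynomials define $$\langle f,g\rangle_{\mathsf s}=\int_0^{+\infty}f(x)g(x)x^\alpha e^{-x}\,dx+\sum_{(j,k)\in I_+}\lambda_{j,k}f^{(k)}(c_j)g^{(k)}(c_j).$$ $S_n$ is the monic polynomial of degree $n$ with $\langle S_n,x^k\rangle_{\mathsf s}=0$ for $k=0,\dots,n-1$ (it exists and is unique). $L_n^\alpha$ is the monic Laguerre polynomial of degree $n$, orthogonal with respect to $x^\alpha e^{-x}dx$ on $(0,+\infty)$. Notation. $h_n^\alpha=n!\,\Gamma(n+\alpha+1)$, $\gamma_n=n(n+\alpha)$, $\beta_n=2n+\alpha+1$. $T_k(x,y;f)=\sum_{\nu=0}^k\frac{f^{(\nu)}(y)}{\nu!}(x-y)^\nu$. $\rho(x)=\prod_{j=1}^N(x-c_j)^{d_j+1}$, $d=\sum_{j=1}^N(d_j+1)=\deg\rho$, and $\rho_{j,k}(x)=\rho(x)/(x-c_j)^{k+1}$.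 For a polynomial $p$ of degree $m$ with leading coefficient $a$, $\mathrm{DgCo}(p)=(m,a)$. For $n\ge 1$: $$\sigma_n=\frac1{h^\alpha_{n-1}}\sum_{(j,k)\in I_+}\lambda_{j,k}S_n^{(k)}(c_j)(L_n^\alpha)^{(k)}(c_j),$$ $$F_{2,n}(x)=\rho(x)-\sum_{(j,k)\in I_+}\frac{k!\,\lambda_{j,k}S_n^{(k)}(c_j)}{h^\alpha_{n-1}}T_k(x,c_j;L^\alpha_{n-1})\rho_{j,k}(x),$$ $$G_{2,n}(x)=\sum_{(j,k)\in I_+}\frac{k!\,\lambda_{j,k}S_n^{(k)}(c_j)}{h^\alpha_{n-1}}T_k(x,c_j;L^\alpha_{n})\rho_{j,k}(x),$$ $$F_{3,n}(x)=xF_{2,n}'(x)+nF_{2,n}(x)-G_{2,n}(x),\qquad G_{3,n}(x)=xG_{2,n}'(x)+\gamma_nF_{2,n}(x)-(n+\alpha-x)G_{2,n}(x).$$ For $n\ge2$ and $i\in\{2,3\}$: $$V_{i,n}(x)=-\frac{G_{i,n-1}(x)}{\gamma_{n-1}},\qquad W_{i,n}(x)=F_{i,n-1}(x)+G_{i,n-1}(x)\,\frac{x-\beta_{n-1}}{\gamma_{n-1}},$$ $$\Delta_n(x)=F_{2,n}(x)W_{2,n}(x)-V_{2,n}(x)G_{2,n}(x),\qquad \delta_n(x)=\frac{\Delta_n(x)}{\rho(x)},$$ where $\rho$ divides $\Delta_n$, so that $\delta_n$ is a polynomial. *)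

theory Defs
  imports
    "HOL-Analysis.Analysis"
    "HOL-Computational_Algebra.Polynomial_Factorial"
begin

definition laguerre_ip :: "real \<Rightarrow> real poly \<Rightarrow> real poly \<Rightarrow> real" where
  "laguerre_ip \<alpha> f g =
     (LBINT x:{0<..}. poly f x * poly g x * x powr \<alpha> * exp (- x))"

text \<open>
  The discrete part of the inner product is given by \<open>N\<close> mass points \<open>c 1, \<dots>, c N\<close>,
  maximal derivative orders \<open>d 1, \<dots>, d N\<close> and weights \<open>lam j k\<close>.  The values of \<open>c\<close>, \<open>d\<close>,
  \<open>lam\<close> outside \<open>1 \<le> j \<le> N\<close>, \<open>k \<le> d j\<close> are never used.
\<close>

definition Iplus :: "nat \<Rightarrow> (nat \<Rightarrow> nat) \<Rightarrow> (nat \<Rightarrow> nat \<Rightarrow> real) \<Rightarrow> (nat \<times> nat) set" where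
  "Iplus N d lam = {(j, k). j \<in> {1..N} \<and> k \<le> d j \<and> lam j k > 0}"

definition sobolev_ip ::
  "real \<Rightarrow> nat \<Rightarrow> (nat \<Rightarrow> real) \<Rightarrow> (nat \<Rightarrow> nat) \<Rightarrow> (nat \<Rightarrow> nat \<Rightarrow> real)
     \<Rightarrow> real poly \<Rightarrow> real poly \<Rightarrow> real" where
  "sobolev_ip \<alpha> N c d lam f g = laguerre_ip \<alpha> f g
     + (\<Sum>(j, k)\<in>Iplus N d lam.
          lam j k * poly ((pderiv ^^ k) f) (c j) * poly ((pderiv ^^ k) g) (c j))"

definition monic_orth_poly :: "(real poly \<Rightarrow> real poly \<Rightarrow> real) \<Rightarrow> nat \<Rightarrow> real poly" where
  "monic_orth_poly ip n =
     (THE p. degree p = n \<and> lead_coeff p = 1 \<and> (\<forall>k<n. ip p (monom 1 k) = 0))"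

definition laguerre :: "real \<Rightarrow> nat \<Rightarrow> real poly" where
  "laguerre \<alpha> n = monic_orth_poly (laguerre_ip \<alpha>) n"

definition sobolev_poly ::
  "real \<Rightarrow> nat \<Rightarrow> (nat \<Rightarrow> real) \<Rightarrow> (nat \<Rightarrow> nat) \<Rightarrow> (nat \<Rightarrow> nat \<Rightarrow> real)
     \<Rightarrow> nat \<Rightarrow> real poly" where
  "sobolev_poly \<alpha> N c d lam n = monic_orth_poly (sobolev_ip \<alpha> N c d lam) n"

definition lag_h :: "real \<Rightarrow> nat \<Rightarrow> real" where
  "lag_h \<alpha> n = fact n * Gamma (real n + \<alpha> + 1)"

definition lag_gamma :: "real \<Rightarrow> nat \<Rightarrow> real" where
  "lag_gamma \<alpha> n = real n * (real n + \<alpha>)"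

definition lag_beta :: "real \<Rightarrow> nat \<Rightarrow> real" where
  "lag_beta \<alpha> n = 2 * real n + \<alpha> + 1"

definition taylor_poly :: "nat \<Rightarrow> real \<Rightarrow> real poly \<Rightarrow> real poly" where
  "taylor_poly k y f =
     (\<Sum>\<nu>\<le>k. smult (poly ((pderiv ^^ \<nu>) f) y / fact \<nu>) ([:- y, 1:] ^ \<nu>))"

definition rho :: "nat \<Rightarrow> (nat \<Rightarrow> real) \<Rightarrow> (nat \<Rightarrow> nat) \<Rightarrow> real poly" where
  "rho N c d = (\<Prod>j=1..N. [:- c j, 1:] ^ (d j + 1))"

definition rho_deg :: "nat \<Rightarrow> (nat \<Rightarrow> nat) \<Rightarrow> nat" where
  "rho_deg N d = (\<Sum>j=1..N. (d j + 1))"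

(* The division is exact for 1 \<le> j \<le> N and k \<le> d j. *)
definition rho_jk :: "nat \<Rightarrow> (nat \<Rightarrow> real) \<Rightarrow> (nat \<Rightarrow> nat) \<Rightarrow> nat \<Rightarrow> nat \<Rightarrow> real poly" where
  "rho_jk N c d j k = rho N c d div [:- c j, 1:] ^ (k + 1)"

definition DgCo :: "real poly \<Rightarrow> nat \<times> real" where
  "DgCo p = (degree p, lead_coeff p)"

text \<open>
  In what follows the index \<open>n - 1\<close> is only meant for \<open>n \<ge> 1\<close> in \<open>lag_sigma\<close>, \<open>F2\<close>, \<open>G2\<close>, \<open>F3\<close>, \<open>G3\<close>
  and for \<open>n \<ge> 2\<close> in everything built from \<open>V2\<close>, \<open>W2\<close>, \<open>V3\<close>, \<open>W3\<close>.
\<close>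

definition lag_sigma where
  "lag_sigma \<alpha> N c d lam n =
     (1 / lag_h \<alpha> (n - 1)) *
     (\<Sum>(j, k)\<in>Iplus N d lam. lam j k
         * poly ((pderiv ^^ k) (sobolev_poly \<alpha> N c d lam n)) (c j)
         * poly ((pderiv ^^ k) (laguerre \<alpha> n)) (c j))"

definition F2 where
  "F2 \<alpha> N c d lam n = rho N c d -
     (\<Sum>(j, k)\<in>Iplus N d lam.
        smult (fact k * lam j k * poly ((pderiv ^^ k) (sobolev_poly \<alpha> N c d lam n)) (c j)
                 / lag_h \<alpha> (n - 1))
          (taylor_poly k (c j) (laguerre \<alpha> (n - 1)) * rho_jk N c d j k))"

definition G2 where
  "G2 \<alpha> N c d lam n =
     (\<Sum>(j, k)\<in>Iplus N d lam.
        smult (fact k * lam j k * poly ((pderiv ^^ k) (sobolev_poly \<alpha> N c d lam n)) (c j)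
                 / lag_h \<alpha> (n - 1))
          (taylor_poly k (c j) (laguerre \<alpha> n) * rho_jk N c d j k))"

definition F3 where
  "F3 \<alpha> N c d lam n =
     [:0, 1:] * pderiv (F2 \<alpha> N c d lam n) + smult (real n) (F2 \<alpha> N c d lam n)
       - G2 \<alpha> N c d lam n"

definition G3 where
  "G3 \<alpha> N c d lam n =
     [:0, 1:] * pderiv (G2 \<alpha> N c d lam n) + smult (lag_gamma \<alpha> n) (F2 \<alpha> N c d lam n)
       - [:real n + \<alpha>, - 1:] * G2 \<alpha> N c d lam n"

definition V2 where
  "V2 \<alpha> N c d lam n = - smult (1 / lag_gamma \<alpha> (n - 1)) (G2 \<alpha> N c d lam (n - 1))"

definition V3 where
  "V3 \<alpha> N c d lam n = - smult (1 / lag_gamma \<alpha> (n - 1)) (G3 \<alpha> N c d lam (n - 1))"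

definition W2 where
  "W2 \<alpha> N c d lam n = F2 \<alpha> N c d lam (n - 1)
     + G2 \<alpha> N c d lam (n - 1)
       * smult (1 / lag_gamma \<alpha> (n - 1)) [:- lag_beta \<alpha> (n - 1), 1:]"

definition W3 where
  "W3 \<alpha> N c d lam n = F3 \<alpha> N c d lam (n - 1)
     + G3 \<alpha> N c d lam (n - 1)
       * smult (1 / lag_gamma \<alpha> (n - 1)) [:- lag_beta \<alpha> (n - 1), 1:]"

definition Delta where
  "Delta \<alpha> N c d lam n =
     F2 \<alpha> N c d lam n * W2 \<alpha> N c d lam n - V2 \<alpha> N c d lam n * G2 \<alpha> N c d lam n"

(* Under the standing assumptions rho divides Delta for n \<ge> 2, so this is the exact quotient. *)
definition delta where
  "delta \<alpha> N c d lam n = Delta \<alpha> N c d lam n div rho N c d"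

definition q0 where
  "q0 \<alpha> N c d lam n = [:0, 1:] * Delta \<alpha> N c d lam n"

definition q1 where
  "q1 \<alpha> N c d lam n =
     G3 \<alpha> N c d lam n * F2 \<alpha> N c d lam n - F3 \<alpha> N c d lam n * G2 \<alpha> N c d lam n"

definition q2 where
  "q2 \<alpha> N c d lam n =
     [:0, 1:] * pderiv (rho N c d) * delta \<alpha> N c d lam n
       + G3 \<alpha> N c d lam n * V2 \<alpha> N c d lam n - F3 \<alpha> N c d lam n * W2 \<alpha> N c d lam n"

definition q3 where
  "q3 \<alpha> N c d lam n =
     [:0, 1:] * pderiv (rho N c d) * delta \<alpha> N c d lam n
       + V3 \<alpha> N c d lam n * G2 \<alpha> N c d lam n - W3 \<alpha> N c d lam n * F2 \<alpha> N c d lam n"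

definition q4 where
  "q4 \<alpha> N c d lam n =
     V3 \<alpha> N c d lam n * W2 \<alpha> N c d lam n - W3 \<alpha> N c d lam n * V2 \<alpha> N c d lam n"

text \<open>Rational functions of \<open>x\<close> are elements of the fraction field of \<open>real poly\<close>.\<close>

definition F4 where
  "F4 \<alpha> N c d lam n = to_fract (q2 \<alpha> N c d lam n) / to_fract (q1 \<alpha> N c d lam n)"

definition G4 where
  "G4 \<alpha> N c d lam n = to_fract (q0 \<alpha> N c d lam n) / to_fract (q1 \<alpha> N c d lam n)"

definition V4 where
  "V4 \<alpha> N c d lam n = to_fract (q3 \<alpha> N c d lam n) / to_fract (q4 \<alpha> N c d lam n)"

definition W4 where
  "W4 \<alpha> N c d lam n = to_fract (q0 \<alpha> N c d lam n) / to_fract (q4 \<alpha> N c d lam n)"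

end

theory Submission
  imports Defs
begin

text \<open>
  The monic Laguerre polynomials are obtained from the three-term recurrence, and their
  orthogonality from the closed form
  \<open>\<langle>L\<^sub>n, x\<^sup>k\<rangle> = k (k - 1) \<dots> (k - n + 1) \<Gamma>(k + \<alpha> + 1)\<close>.
  Expanding \<open>S\<^sub>n - L\<^sub>n\<close> in the \<open>L\<^sub>m\<close> with \<open>m < n\<close> expresses it by derivatives of the reproducing
  kernel; the Christoffel-Darboux formula, compared coefficientwise in the Taylor expansion at
  \<open>c\<^sub>j\<close>, turns this into \<open>\<rho> S\<^sub>n = F\<^sub>2 L\<^sub>n + G\<^sub>2 L\<^sub>n\<^sub>-\<^sub>1\<close>.  Together with the same relation for \<open>n - 1\<close>
  this is a linear system for \<open>L\<^sub>n, L\<^sub>n\<^sub>-\<^sub>1\<close> with determinant \<open>\<Delta>\<^sub>n\<close>.  Since \<open>L\<^sub>n\<close> and \<open>L\<^sub>n\<^sub>-\<^sub>1\<close> are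
  coprime, \<open>\<rho>\<close> divides \<open>\<Delta>\<^sub>n\<close>, and solving the system inside \<open>x (\<rho> S\<^sub>n)' = F\<^sub>3 L\<^sub>n + G\<^sub>3 L\<^sub>n\<^sub>-\<^sub>1\<close>
  gives the ladder equations.  The denominators do not vanish because
  \<open>h\<^sub>n\<^sub>-\<^sub>1 (\<gamma>\<^sub>n + \<sigma>\<^sub>n) = \<langle>S\<^sub>n, S\<^sub>n\<rangle>\<^sub>s > 0\<close>.
\<close>

section \<open>Orthogonal polynomials for an inner product\<close>

locale poly_form =
  fixes ip :: "real poly \<Rightarrow> real poly \<Rightarrow> real"
  assumes ip_add_left: "ip (p + q) r = ip p r + ip q r"
    and ip_smult_left: "ip (smult a p) r = a * ip p r"
    and ip_commute: "ip p q = ip q p"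
begin

lemma ip_zero_left [simp]: "ip 0 r = 0"
  using ip_smult_left[of 0 0 r] by simp

lemma ip_diff_left: "ip (p - q) r = ip p r - ip q r"
  using ip_add_left[of p "smult (- 1) q" r] ip_smult_left[of "- 1" q r] by simp

lemma ip_sum_left: "ip (\<Sum>i\<in>A. f i) r = (\<Sum>i\<in>A. ip (f i) r)"
  by (induction A rule: infinite_finite_induct) (auto simp: ip_add_left)

lemma ip_add_right: "ip r (p + q) = ip r p + ip r q"
  by (metis ip_add_left ip_commute)

lemma ip_diff_right: "ip r (p - q) = ip r p - ip r q"
  by (metis ip_diff_left ip_commute)

lemma ip_smult_right: "ip r (smult a p) = a * ip r p"
  by (metis ip_smult_left ip_commute)

text \<open>Degree below \<open>n\<close> is expressed through vanishing coefficients, here and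
  later, because \<open>degree 0 = 0\<close>: this form admits the zero polynomial and remains
  meaningful for \<open>n = 0\<close>.\<close>

lemma ip_orth_lower:
  assumes "\<forall>k<n. ip p (monom 1 k) = 0" "\<forall>k\<ge>n. coeff q k = 0"
  shows "ip p q = 0"
proof -
  have "q = (\<Sum>k<n. smult (coeff q k) (monom 1 k))"
  proof (rule poly_eqI)
    fix i
    have "coeff (\<Sum>k<n. smult (coeff q k) (monom 1 k)) i
        = (\<Sum>k<n. if k = i then coeff q k else 0)"
      unfolding coeff_sum by (rule sum.cong) auto
    then show "coeff q i = coeff (\<Sum>k<n. smult (coeff q k) (monom 1 k)) i"
      using assms(2) by auto
  qed
  then have "ip p q = ip (\<Sum>k<n. smult (coeff q k) (monom 1 k)) p"
    using ip_commute by metis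
  also have "\<dots> = (\<Sum>k<n. coeff q k * ip (monom 1 k) p)"
    by (simp add: ip_sum_left ip_smult_left)
  also have "\<dots> = 0"
    using assms(1) ip_commute by (intro sum.neutral) (metis lessThan_iff mult_zero_right)
  finally show ?thesis .
qed

end

locale poly_inner = poly_form +
  assumes ip_pos: "p \<noteq> 0 \<Longrightarrow> ip p p > 0"
begin

text \<open>One Gram-Schmidt step per degree. The induction hypothesis is used twice, for
  \<open>q\<close> and for the monomial of degree \<open>n\<close>, hence the generalisation over
  \<open>q\<close>.\<close>

lemma projection_exists:
  "\<exists>r. (\<forall>k\<ge>n. coeff r k = 0) \<and> (\<forall>k<n. ip (q - r) (monom 1 k) = 0)"
proof (induction n arbitrary: q)
  case 0
  show ?case by (intro exI[of _ 0]) simp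
next
  case (Suc n)
  obtain r where r: "\<forall>k\<ge>n. coeff r k = 0" "\<forall>k<n. ip (q - r) (monom 1 k) = 0"
    using Suc by blast
  obtain t where t: "\<forall>k\<ge>n. coeff t k = 0" "\<forall>k<n. ip (monom 1 n - t) (monom 1 k) = 0"
    using Suc by blast
  \<comment> \<open>\<open>e\<close> is monic of degree \<open>n\<close> and orthogonal to all lower
    degrees, so adding a multiple of it to \<open>r\<close> preserves the orthogonality already
    obtained.\<close>
  define e where "e = monom 1 n - t"
  have "coeff e n = 1" using t(1) by (simp add: e_def)
  then have "ip e e > 0" by (intro ip_pos) auto
  define s where "s = ip (q - r) e / ip e e"
  have low: "ip (q - (r + smult s e)) (monom 1 k) = 0" if "k < n" for k
    using r(2) t(2) that
    by (simp add: e_def ip_diff_left ip_add_left ip_smult_left)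
  have "ip (q - (r + smult s e)) e = 0"
    using \<open>ip e e > 0\<close> by (simp add: s_def ip_diff_left ip_add_left ip_smult_left)
  moreover have "ip (q - (r + smult s e)) t = 0"
    using ip_orth_lower[of n _ t] low t(1) by blast
  ultimately have "ip (q - (r + smult s e)) (monom 1 n) = 0"
    by (simp add: e_def ip_diff_right)
  with low have "\<forall>k<Suc n. ip (q - (r + smult s e)) (monom 1 k) = 0"
    by (auto simp: less_Suc_eq)
  moreover have "\<forall>k\<ge>Suc n. coeff (r + smult s e) k = 0"
    using r(1) t(1) by (auto simp: e_def)
  ultimately show ?case by blast
qed

text \<open>The leading terms cancel in \<open>p - q\<close>, so this difference has degree below
  \<open>n\<close> and is orthogonal to itself.\<close>

lemma monic_orth_unique:
  assumes "degree p = n" "lead_coeff p = 1" "\<forall>k<n. ip p (monom 1 k) = 0"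
    and "degree q = n" "lead_coeff q = 1" "\<forall>k<n. ip q (monom 1 k) = 0"
  shows "p = q"
proof (rule ccontr)
  assume "p \<noteq> q"
  then have "ip (p - q) (p - q) > 0" by (intro ip_pos) simp
  moreover have "\<forall>k\<ge>n. coeff (p - q) k = 0"
    using assms by (metis coeff_diff coeff_eq_0 diff_self le_neq_implies_less)
  then have "ip (p - q) (p - q) = 0"
    using assms by (intro ip_orth_lower[of n]) (auto simp: ip_diff_left)
  ultimately show False by simp
qed

lemma monic_orth_polyI:
  assumes "degree p = n" "lead_coeff p = 1" "\<forall>k<n. ip p (monom 1 k) = 0"
  shows "monic_orth_poly ip n = p"
  unfolding monic_orth_poly_def
  using assms by (intro the_equality) (auto intro: monic_orth_unique[of _ n])

text \<open>The witness behind \<open>THE\<close> is the monomial of degree \<open>n\<close> minus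
  its projection onto the lower degrees.\<close>

lemma monic_orth_poly:
  shows degree_monic_orth: "degree (monic_orth_poly ip n) = n"
    and lead_coeff_monic_orth: "lead_coeff (monic_orth_poly ip n) = 1"
    and monic_orth_orth: "\<forall>k\<ge>n. coeff q k = 0 \<Longrightarrow> ip (monic_orth_poly ip n) q = 0"
proof -
  obtain r where r: "\<forall>k\<ge>n. coeff r k = 0" "\<forall>k<n. ip (monom 1 n - r) (monom 1 k) = 0"
    using projection_exists by blast
  have c: "coeff (monom 1 n - r) n = 1" using r by simp
  have "degree (monom 1 n - r) \<le> n"
    using r by (intro degree_le) auto
  moreover have "degree (monom 1 n - r) \<ge> n"
    using c by (intro le_degree) simp
  ultimately have deg: "degree (monom 1 n - r) = n" by simp
  have eq: "monic_orth_poly ip n = monom 1 n - r"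
    using deg c r by (intro monic_orth_polyI) auto
  show "degree (monic_orth_poly ip n) = n" "lead_coeff (monic_orth_poly ip n) = 1"
    using eq deg c by simp_all
  show "ip (monic_orth_poly ip n) q = 0" if "\<forall>k\<ge>n. coeff q k = 0"
    unfolding eq using ip_orth_lower[OF r(2) that] .
qed

end

section \<open>Laguerre polynomials\<close>

text \<open>At \<open>n = 0\<close> the truncated index \<open>n - 1\<close> is harmless because \<open>\<gamma>\<^sub>0 = 0\<close>.\<close>

fun lagp :: "real \<Rightarrow> nat \<Rightarrow> real poly" where
  "lagp \<alpha> 0 = 1"
| "lagp \<alpha> (Suc n) = [:- lag_beta \<alpha> n, 1:] * lagp \<alpha> n - smult (lag_gamma \<alpha> n) (lagp \<alpha> (n - 1))"

lemma lag_gamma_0 [simp]: "lag_gamma \<alpha> 0 = 0"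
  by (simp add: lag_gamma_def)

lemma lag_gamma_pos: "\<alpha> > - 1 \<Longrightarrow> n > 0 \<Longrightarrow> lag_gamma \<alpha> n > 0"
  by (simp add: lag_gamma_def)

lemma lag_h_pos: "\<alpha> > - 1 \<Longrightarrow> lag_h \<alpha> n > 0"
  by (simp add: lag_h_def Gamma_real_pos)

lemma lag_h_Suc:
  assumes "\<alpha> > - 1"
  shows "lag_h \<alpha> (Suc n) = lag_gamma \<alpha> (Suc n) * lag_h \<alpha> n"
proof -
  have "Gamma (real n + \<alpha> + 1 + 1) = (real n + \<alpha> + 1) * Gamma (real n + \<alpha> + 1)"
    using assms by (intro Gamma_plus1) (auto elim!: nonpos_Ints_cases)
  then show ?thesis
    by (simp add: lag_h_def lag_gamma_def algebra_simps)
qed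

lemma degree_lagp [simp]: "degree (lagp \<alpha> n) = n"
  and lead_coeff_lagp [simp]: "coeff (lagp \<alpha> n) n = 1"
proof -
  have "degree (lagp \<alpha> n) \<le> n \<and> coeff (lagp \<alpha> n) n = 1"
  proof (induction n rule: less_induct)
    case (less n)
    show ?case
    proof (cases n)
      case (Suc m)
      have m: "degree (lagp \<alpha> m) \<le> m" "coeff (lagp \<alpha> m) m = 1" using less Suc by auto
      have m1: "degree (lagp \<alpha> (m - 1)) \<le> m"
        using less.IH[of "m - 1"] Suc by (auto simp: less_Suc_eq_le)
      have "degree ([:- lag_beta \<alpha> m, 1:] * lagp \<alpha> m) \<le> Suc m"
        using m(1) degree_mult_le[of "[:- lag_beta \<alpha> m, 1:]" "lagp \<alpha> m"] by simp
      then have "degree (lagp \<alpha> n) \<le> n"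
        using m1 Suc by (auto intro!: degree_diff_le degree_smult_le[THEN order_trans])
      moreover have "coeff (lagp \<alpha> n) n = 1"
        using m m1 Suc by (simp add: coeff_eq_0)
      ultimately show ?thesis by simp
    qed simp
  qed
  then show "coeff (lagp \<alpha> n) n = 1" "degree (lagp \<alpha> n) = n"
    using le_degree[of "lagp \<alpha> n" n] by auto
qed

section \<open>Integrals against the Laguerre weight\<close>

lemma laguerre_moment:
  assumes "\<alpha> > - 1"
  shows "has_bochner_integral lborel
     (\<lambda>x. indicator {0<..} x * (x ^ k * x powr \<alpha> * exp (- x))) (Gamma (real k + \<alpha> + 1))"
proof -
  \<comment> \<open>Since \<open>0 powr a = 0\<close>, including the endpoint 0 leaves the integrand
    unchanged, and it becomes exactly Euler's integrand for Gamma.\<close>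
  have eq: "indicator {0<..} x * (x ^ k * x powr \<alpha> * exp (- x))
     = indicator {0..} x * x powr (real k + \<alpha> + 1 - 1) / exp x" for x :: real
    by (auto simp: indicator_def powr_add powr_realpow exp_minus field_simps)
  have "real k + \<alpha> + 1 > 0" using assms by simp
  then show ?thesis
    unfolding eq using Gamma_conv_nn_integral_real[of "real k + \<alpha> + 1"]
    by (intro has_bochner_integral_nn_integral) (auto simp: Gamma_real_pos)
qed

lemma set_integrable_poly_laguerre_weight:
  fixes p :: "real poly"
  assumes "\<alpha> > - 1"
  shows "set_integrable lborel {0<..} (\<lambda>x. poly p x * x powr \<alpha> * exp (- x))"
proof -
  have "integrable lborel (\<lambda>x. \<Sum>k\<le>degree p.
      coeff p k * (indicator {0<..} x * (x ^ k * x powr \<alpha> * exp (- x))))"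
    using laguerre_moment[OF assms]
    by (intro Bochner_Integration.integrable_sum integrable_mult_right)
      (auto simp: has_bochner_integral_iff)
  also have "(\<lambda>x. \<Sum>k\<le>degree p.
      coeff p k * (indicator {0<..} x * (x ^ k * x powr \<alpha> * exp (- x))))
      = (\<lambda>x. indicator {0<..} x *\<^sub>R (poly p x * x powr \<alpha> * exp (- x)))"
    by (auto simp: poly_altdef sum_distrib_left sum_distrib_right mult_ac)
  finally show ?thesis unfolding set_integrable_def .
qed

lemma laguerre_ip_shift: "laguerre_ip \<alpha> (f * g) q = laguerre_ip \<alpha> f (g * q)"
  by (simp add: laguerre_ip_def mult.assoc)

lemma laguerre_ip_commute: "laguerre_ip \<alpha> f g = laguerre_ip \<alpha> g f"
  by (simp add: laguerre_ip_def mult_ac)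

lemma laguerre_ip_add_left:
  assumes "\<alpha> > - 1"
  shows "laguerre_ip \<alpha> (f + g) q = laguerre_ip \<alpha> f q + laguerre_ip \<alpha> g q"
  using set_integral_add(2)[OF set_integrable_poly_laguerre_weight[OF assms, of "f * q"]
      set_integrable_poly_laguerre_weight[OF assms, of "g * q"]]
  by (simp add: laguerre_ip_def algebra_simps)

lemma laguerre_ip_smult_left: "laguerre_ip \<alpha> (smult a f) q = a * laguerre_ip \<alpha> f q"
  unfolding laguerre_ip_def
  by (subst set_integral_mult_right[symmetric]) (simp add: mult_ac)

lemma laguerre_ip_diff_left:
  assumes "\<alpha> > - 1"
  shows "laguerre_ip \<alpha> (f - g) q = laguerre_ip \<alpha> f q - laguerre_ip \<alpha> g q"
  using laguerre_ip_add_left[OF assms, of f "smult (- 1) g" q]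
    laguerre_ip_smult_left[of \<alpha> "- 1" g q] by simp

lemma laguerre_ip_1_monom:
  assumes "\<alpha> > - 1"
  shows "laguerre_ip \<alpha> 1 (monom 1 k) = Gamma (real k + \<alpha> + 1)"
  using laguerre_moment[OF assms, of k, THEN has_bochner_integral_integral_eq]
  by (simp add: laguerre_ip_def set_lebesgue_integral_def poly_monom)

text \<open>Induction along the recurrence, where the factor x raises the exponent \<open>k\<close>
  by one. The product vanishes for \<open>k < n\<close> and equals n! for \<open>k = n\<close>, so
  it yields both the orthogonality and the norm \<open>lag_h\<close>.\<close>

lemma laguerre_ip_lagp_monom:
  assumes "\<alpha> > - 1"
  shows "laguerre_ip \<alpha> (lagp \<alpha> n) (monom 1 k)
           = (\<Prod>i<n. real k - real i) * Gamma (real k + \<alpha> + 1)"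
proof (induction n arbitrary: k rule: less_induct)
  case (less n)
  show ?case
  proof (cases n)
    case 0
    then show ?thesis using laguerre_ip_1_monom[OF assms] by simp
  next
    case (Suc m)
    have G: "Gamma (real k + \<alpha> + 1 + 1) = (real k + \<alpha> + 1) * Gamma (real k + \<alpha> + 1)"
      using assms by (intro Gamma_plus1) (auto elim!: nonpos_Ints_cases)
    have "lagp \<alpha> n = lagp \<alpha> m * monom 1 1 - smult (lag_beta \<alpha> m) (lagp \<alpha> m)
        - smult (lag_gamma \<alpha> m) (lagp \<alpha> (m - 1))"
      using Suc by (simp add: monom_altdef algebra_simps)
    then have "laguerre_ip \<alpha> (lagp \<alpha> n) (monom 1 k) =
        laguerre_ip \<alpha> (lagp \<alpha> m) (monom 1 (Suc k))
        - lag_beta \<alpha> m * laguerre_ip \<alpha> (lagp \<alpha> m) (monom 1 k)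
        - lag_gamma \<alpha> m * laguerre_ip \<alpha> (lagp \<alpha> (m - 1)) (monom 1 k)"
      by (simp add: laguerre_ip_diff_left[OF assms] laguerre_ip_smult_left laguerre_ip_shift mult_monom)
    also have "\<dots> = (\<Prod>i<m. real (Suc k) - real i) * Gamma (real k + \<alpha> + 1 + 1)
        - lag_beta \<alpha> m * ((\<Prod>i<m. real k - real i) * Gamma (real k + \<alpha> + 1))
        - lag_gamma \<alpha> m * ((\<Prod>i<m - 1. real k - real i) * Gamma (real k + \<alpha> + 1))"
      using less[of m] less[of "m - 1"] Suc by (simp add: add_ac)
    also have "\<dots> = (\<Prod>i<n. real k - real i) * Gamma (real k + \<alpha> + 1)"
    proof (cases m)
      case 0
      then show ?thesis using Suc G by (simp add: lag_beta_def algebra_simps)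
    next
      case m: (Suc l)
      \<comment> \<open>Pulling out the first factor leaves a product common to all terms; what
        remains is a quadratic identity in \<open>k\<close>.\<close>
      have "(\<Prod>i<m. real (Suc k) - real i) = (real k + 1) * (\<Prod>i<l. real k - real i)"
        unfolding m prod.lessThan_Suc_shift by simp
      then show ?thesis
        unfolding G Suc m by (simp add: lag_beta_def lag_gamma_def algebra_simps)
    qed
    finally show ?thesis .
  qed
qed

lemma poly_form_laguerre:
  assumes "\<alpha> > - 1"
  shows "poly_form (laguerre_ip \<alpha>)"
  using laguerre_ip_add_left[OF assms] laguerre_ip_smult_left laguerre_ip_commute
  by unfold_locales auto

lemma laguerre_ip_lagp_lower:
  assumes "\<alpha> > - 1" "\<forall>k\<ge>n. coeff q k = 0"
  shows "laguerre_ip \<alpha> (lagp \<alpha> n) q = 0"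
  using assms
  by (intro poly_form.ip_orth_lower[OF poly_form_laguerre, of _ n])
    (auto simp: laguerre_ip_lagp_monom)

lemma laguerre_ip_lagp_top:
  assumes "\<alpha> > - 1" "degree q \<le> n"
  shows "laguerre_ip \<alpha> (lagp \<alpha> n) q = coeff q n * lag_h \<alpha> n"
proof -
  interpret poly_form "laguerre_ip \<alpha>" by (rule poly_form_laguerre) fact
  have "(\<Prod>i<n. real n - real i) = fact n"
    by (subst prod.nat_diff_reindex[symmetric])
      (simp add: fact_prod_Suc of_nat_diff lessThan_atLeast0)
  then have "laguerre_ip \<alpha> (lagp \<alpha> n) (monom 1 n) = lag_h \<alpha> n"
    by (simp add: laguerre_ip_lagp_monom[OF assms(1)] lag_h_def)
  moreover have "\<forall>k\<ge>n. coeff (q - smult (coeff q n) (monom 1 n)) k = 0"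
    using assms(2) by (auto simp: coeff_eq_0)
  from laguerre_ip_lagp_lower[OF assms(1) this]
  have "laguerre_ip \<alpha> (lagp \<alpha> n) q
      = coeff q n * laguerre_ip \<alpha> (lagp \<alpha> n) (monom 1 n)"
    by (simp only: ip_diff_right ip_smult_right)
  ultimately show ?thesis by simp
qed

text \<open>Positivity follows algebraically: splitting off the leading multiple of
  \<open>lagp \<alpha> n\<close> is an orthogonal decomposition, and the remainder is covered by
  induction on the degree.\<close>

lemma laguerre_ip_pos:
  assumes "\<alpha> > - 1" "p \<noteq> 0"
  shows "laguerre_ip \<alpha> p p > 0"
  using assms(2)
proof (induction "degree p" arbitrary: p rule: less_induct)
  case less
  interpret poly_form "laguerre_ip \<alpha>" by (rule poly_form_laguerre) fact
  define n a where "n = degree p" and "a = lead_coeff p"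
  define r where "r = p - smult a (lagp \<alpha> n)"
  have r: "\<forall>k\<ge>n. coeff r k = 0"
    by (auto simp: r_def a_def n_def coeff_eq_0 le_less)
  have "laguerre_ip \<alpha> r r \<ge> 0"
  proof (cases "r = 0")
    case False
    then have "degree r < n" using r leading_coeff_neq_0 not_less by blast
    then show ?thesis using less False by (simp add: n_def less_imp_le)
  qed simp
  moreover have "p = smult a (lagp \<alpha> n) + r" by (simp add: r_def)
  then have "laguerre_ip \<alpha> p p = a\<^sup>2 * lag_h \<alpha> n + laguerre_ip \<alpha> r r"
    using laguerre_ip_lagp_lower[OF assms(1) r] laguerre_ip_lagp_top[OF assms(1), of "lagp \<alpha> n" n]
      laguerre_ip_commute[of \<alpha> r "lagp \<alpha> n"]
    by (simp add: ip_add_left ip_add_right ip_smult_left ip_smult_right power2_eq_square)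
  moreover have "a\<^sup>2 * lag_h \<alpha> n > 0"
    using less.prems lag_h_pos[OF assms(1)] by (simp add: a_def)
  ultimately show ?case by linarith
qed

lemma poly_inner_laguerre:
  assumes "\<alpha> > - 1"
  shows "poly_inner (laguerre_ip \<alpha>)"
  using poly_form_laguerre[OF assms] laguerre_ip_pos[OF assms]
  by (intro poly_inner.intro poly_inner_axioms.intro)

lemma laguerre_eq_lagp:
  assumes "\<alpha> > - 1"
  shows "laguerre \<alpha> n = lagp \<alpha> n"
  unfolding laguerre_def
  by (intro poly_inner.monic_orth_polyI poly_inner_laguerre assms)
    (auto simp: laguerre_ip_lagp_monom[OF assms])

section \<open>Derivatives and coprimality of consecutive Laguerre polynomials\<close>

text \<open>The recurrence is differentiated, and the induction hypothesis is applied to both lower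
  indices.\<close>

lemma lagp_pderiv:
  "[:0, 1:] * pderiv (lagp \<alpha> n) = smult (real n) (lagp \<alpha> n) + smult (lag_gamma \<alpha> n) (lagp \<alpha> (n - 1))"
proof (induction n rule: less_induct)
  case (less n)
  consider "n = 0" | "n = 1" | l where "n = Suc (Suc l)"
    by (metis One_nat_def not0_implies_Suc)
  then show ?case
  proof cases
    case 3
    have "x * poly (pderiv (lagp \<alpha> n)) x = real n * poly (lagp \<alpha> n) x
            + lag_gamma \<alpha> n * poly (lagp \<alpha> (n - 1)) x" for x
    proof -
      have IH: "x * poly (pderiv (lagp \<alpha> i)) x = real i * poly (lagp \<alpha> i) x
            + lag_gamma \<alpha> i * poly (lagp \<alpha> (i - 1)) x" if "i < n" for i
        using less.IH[OF that, THEN arg_cong[where f = "\<lambda>p. poly p x"]] by simp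
      define a b e where "a = poly (lagp \<alpha> (Suc l)) x" and "b = poly (lagp \<alpha> l) x"
        and "e = poly (lagp \<alpha> (l - 1)) x"
      have a: "a = (x - lag_beta \<alpha> l) * b - lag_gamma \<alpha> l * e"
        by (simp add: a_def b_def e_def algebra_simps)
      have "x * poly (pderiv (lagp \<alpha> n)) x
          = x * a + (x - lag_beta \<alpha> (Suc l)) * (x * poly (pderiv (lagp \<alpha> (Suc l))) x)
            - lag_gamma \<alpha> (Suc l) * (x * poly (pderiv (lagp \<alpha> l)) x)"
        unfolding 3 a_def lagp.simps(2)[of \<alpha> "Suc l"] pderiv_diff pderiv_mult pderiv_smult
        by (simp add: pderiv_pCons algebra_simps)
      also have "\<dots> = x * a + (x - lag_beta \<alpha> (Suc l)) * (real (Suc l) * a + lag_gamma \<alpha> (Suc l) * b)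
            - lag_gamma \<alpha> (Suc l) * (real l * b + lag_gamma \<alpha> l * e)"
        using IH[of "Suc l"] IH[of l] 3 by (simp add: a_def b_def e_def)
      \<comment> \<open>Eliminating the third consecutive value leaves an identity in
        \<open>a\<close> and \<open>b\<close> alone.\<close>
      also have "lag_gamma \<alpha> l * e = (x - lag_beta \<alpha> l) * b - a"
        using a by simp
      also have "x * a + (x - lag_beta \<alpha> (Suc l)) * (real (Suc l) * a + lag_gamma \<alpha> (Suc l) * b)
            - lag_gamma \<alpha> (Suc l) * (real l * b + ((x - lag_beta \<alpha> l) * b - a))
          = real n * ((x - lag_beta \<alpha> (Suc l)) * a - lag_gamma \<alpha> (Suc l) * b) + lag_gamma \<alpha> n * a"
        unfolding 3 by (simp add: lag_beta_def lag_gamma_def algebra_simps)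
      also have "(x - lag_beta \<alpha> (Suc l)) * a - lag_gamma \<alpha> (Suc l) * b = poly (lagp \<alpha> n) x"
        unfolding 3 a_def b_def lagp.simps(2)[of \<alpha> "Suc l"] by (simp add: algebra_simps del: lagp.simps(2))
      also have "a = poly (lagp \<alpha> (n - 1)) x"
        by (simp add: 3 a_def)
      finally show ?thesis .
    qed
    then show ?thesis by (intro poly_ext) simp
  qed (auto simp: lag_beta_def lag_gamma_def pderiv_pCons one_pCons)
qed

text \<open>The raising form of the derivative formula. It differentiates the lower member of the
  pair L_n, L_{n-1} without introducing L_{n-2}.\<close>

lemma lagp_pderiv_Suc:
  "[:0, 1:] * pderiv (lagp \<alpha> n) = [:- (real n + 1 + \<alpha>), 1:] * lagp \<alpha> n - lagp \<alpha> (Suc n)"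
  unfolding lagp_pderiv
  by (rule poly_ext) (simp add: lag_beta_def algebra_simps)

text \<open>A Euclidean step backwards: as \<open>lag_gamma\<close> is nonzero at positive indices,
  the recurrence can be solved for its lowest member and substituted into the previous Bezout
  identity.\<close>

lemma lagp_bezout:
  assumes "\<alpha> > - 1"
  shows "\<exists>u v. u * lagp \<alpha> (Suc n) + v * lagp \<alpha> n = 1"
proof (induction n)
  case 0
  show ?case by (intro exI[of _ 0] exI[of _ 1]) simp
next
  case (Suc n)
  then obtain u v where uv: "u * lagp \<alpha> (Suc n) + v * lagp \<alpha> n = 1" by blast
  define g where "g = lag_gamma \<alpha> (Suc n)"
  have "g \<noteq> 0" using lag_gamma_pos[OF assms, of "Suc n"] by (simp add: g_def)
  then have "lagp \<alpha> n = smult (1 / g) (smult g (lagp \<alpha> n))" by simp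
  also have "smult g (lagp \<alpha> n)
      = [:- lag_beta \<alpha> (Suc n), 1:] * lagp \<alpha> (Suc n) - lagp \<alpha> (Suc (Suc n))"
    by (simp add: g_def)
  finally have L: "lagp \<alpha> n = smult (1 / g)
      ([:- lag_beta \<alpha> (Suc n), 1:] * lagp \<alpha> (Suc n) - lagp \<alpha> (Suc (Suc n)))" .
  have "u * lagp \<alpha> (Suc n) + v * smult (1 / g)
      ([:- lag_beta \<alpha> (Suc n), 1:] * lagp \<alpha> (Suc n) - lagp \<alpha> (Suc (Suc n))) = 1"
    unfolding L[symmetric] by (rule uv)
  then have "(- smult (1 / g) v) * lagp \<alpha> (Suc (Suc n))
      + (u + smult (1 / g) (v * [:- lag_beta \<alpha> (Suc n), 1:])) * lagp \<alpha> (Suc n) = 1"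
    by (simp add: algebra_simps smult_diff_right del: lagp.simps(2) mult_pCons_left mult_pCons_right)
  then show ?case by blast
qed

section \<open>The reproducing kernel\<close>

text \<open>With the factorial divided out, multiplication by x - c becomes a plain index
  shift.\<close>

definition taylor_coeff :: "real \<Rightarrow> nat \<Rightarrow> real poly \<Rightarrow> real" where
  "taylor_coeff c k p = poly ((pderiv ^^ k) p) c / fact k"

lemma higher_pderiv_diff: "(pderiv ^^ k) (p - q) = (pderiv ^^ k) p - (pderiv ^^ k) (q :: real poly)"
  by (induction k) (simp_all add: pderiv_diff)

text \<open>Leibniz' rule stops after two terms for a linear factor. At \<open>k = 0\<close> the
  factor \<open>real k\<close> removes the term with the truncated index
  \<open>k - 1\<close>.\<close>

lemma higher_pderiv_linear_mult:
  "(pderiv ^^ k) ([:a, 1:] * p) = [:a, 1:] * (pderiv ^^ k) p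
     + smult (real k) ((pderiv ^^ (k - 1)) (p :: real poly))"
proof (induction k)
  case (Suc k)
  have "(pderiv ^^ Suc k) ([:a, 1:] * p)
      = pderiv ([:a, 1:] * (pderiv ^^ k) p + smult (real k) ((pderiv ^^ (k - 1)) p))"
    by (simp only: funpow.simps o_apply Suc)
  also have "\<dots> = [:a, 1:] * (pderiv ^^ Suc k) p + smult (real (Suc k)) ((pderiv ^^ (Suc k - 1)) p)"
    by (rule poly_ext, cases k)
      (simp_all add: pderiv_add pderiv_smult pderiv_mult pderiv_pCons algebra_simps)
  finally show ?case .
qed simp

lemma taylor_coeff_diff: "taylor_coeff c k (p - q) = taylor_coeff c k p - taylor_coeff c k q"
  by (simp add: taylor_coeff_def higher_pderiv_diff diff_divide_distrib)

lemma taylor_coeff_smult: "taylor_coeff c k (smult a p) = a * taylor_coeff c k p"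
  by (simp add: taylor_coeff_def higher_pderiv_smult)

lemma taylor_coeff_linear_mult:
  "taylor_coeff c k ([:a, 1:] * p)
     = (a + c) * taylor_coeff c k p + (if k = 0 then 0 else taylor_coeff c (k - 1) p)"
  unfolding taylor_coeff_def higher_pderiv_linear_mult
  by (cases k) (simp_all add: add_divide_distrib distrib_right del: of_nat_Suc)

lemma taylor_coeff_lagp_Suc:
  "taylor_coeff c k (lagp \<alpha> (Suc n)) = (c - lag_beta \<alpha> n) * taylor_coeff c k (lagp \<alpha> n)
     + (if k = 0 then 0 else taylor_coeff c (k - 1) (lagp \<alpha> n))
     - lag_gamma \<alpha> n * taylor_coeff c k (lagp \<alpha> (n - 1))"
  by (simp only: lagp.simps taylor_coeff_diff taylor_coeff_smult taylor_coeff_linear_mult) simp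

section \<open>The Christoffel-Darboux formula in Taylor coefficients\<close>

text \<open>The \<open>k\<close>-th Taylor coefficient at \<open>y = c\<close> of the reproducing kernel
  \<open>K(x, y) = \<Sum>m<n. L\<^sub>m(x) L\<^sub>m(y) / h\<^sub>m\<close>, as a polynomial in \<open>x\<close>.\<close>

definition lag_kernel :: "real \<Rightarrow> nat \<Rightarrow> real \<Rightarrow> nat \<Rightarrow> real poly" where
  "lag_kernel \<alpha> n c k = (\<Sum>m<n. smult (taylor_coeff c k (lagp \<alpha> m) / lag_h \<alpha> m) (lagp \<alpha> m))"

text \<open>This is the Christoffel-Darboux formula for (x - y) K(x, y), read off at the
  \<open>k\<close>-th Taylor coefficient in y at \<open>c\<close>. Writing x - y = (x - c) - (y -
  c), the factor y - c lowers the Taylor index and produces the kernel with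
  \<open>k - 1\<close>.\<close>

lemma lag_kernel_step:
  assumes "\<alpha> > - 1"
  shows "[:- c, 1:] * lag_kernel \<alpha> (Suc n) c k
           = (if k = 0 then 0 else lag_kernel \<alpha> (Suc n) c (k - 1))
             + smult (1 / lag_h \<alpha> n) (smult (taylor_coeff c k (lagp \<alpha> n)) (lagp \<alpha> (Suc n))
                 - smult (taylor_coeff c k (lagp \<alpha> (Suc n))) (lagp \<alpha> n))"
proof (rule poly_ext)
  fix x
  define a where "a = (\<lambda>m. taylor_coeff c k (lagp \<alpha> m))"
  define b where "b = (\<lambda>m. if k = 0 then 0 else taylor_coeff c (k - 1) (lagp \<alpha> m))"
  define L where "L = (\<lambda>m. poly (lagp \<alpha> m) x)"
  define h where "h = lag_h \<alpha>"
  have L: "L (Suc m) = (x - lag_beta \<alpha> m) * L m - lag_gamma \<alpha> m * L (m - 1)" for m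
    by (simp add: L_def algebra_simps)
  have A: "a (Suc m) = (c - lag_beta \<alpha> m) * a m + b m - lag_gamma \<alpha> m * a (m - 1)" for m
    unfolding a_def b_def by (rule taylor_coeff_lagp_Suc)
  have h: "h m > 0" for m unfolding h_def by (rule lag_h_pos) fact
  have hS: "h (Suc m) = lag_gamma \<alpha> (Suc m) * h m" for m
    unfolding h_def by (rule lag_h_Suc) fact
  have "(x - c) * (\<Sum>m<Suc n. a m / h m * L m) - (\<Sum>m<Suc n. b m / h m * L m)
      = (a n * L (Suc n) - a (Suc n) * L n) / h n"
  proof (induction n)
    case 0
    \<comment> \<open>\<open>lag_gamma \<alpha> 0 = 0\<close> removes the terms with index
      \<open>0 - 1\<close>.\<close>
    have AL: "a (Suc 0) = (c - lag_beta \<alpha> 0) * a 0 + b 0" "L (Suc 0) = (x - lag_beta \<alpha> 0) * L 0"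
      using A[of 0] L[of 0] by simp_all
    show ?case
      unfolding AL by (simp add: algebra_simps diff_divide_distrib add_divide_distrib)
  next
    case (Suc n)
    have g: "lag_gamma \<alpha> (Suc n) \<noteq> 0" using lag_gamma_pos[OF assms, of "Suc n"] by simp
    have "(x - c) * (\<Sum>m<Suc (Suc n). a m / h m * L m) - (\<Sum>m<Suc (Suc n). b m / h m * L m)
      = ((x - c) * (\<Sum>m<Suc n. a m / h m * L m) - (\<Sum>m<Suc n. b m / h m * L m))
        + ((x - c) * a (Suc n) - b (Suc n)) * L (Suc n) / h (Suc n)"
      using h[of "Suc n"] by (simp add: field_simps)
    \<comment> \<open>\<open>hS\<close> brings the old boundary term over the new denominator; the
      two recurrences then telescope.\<close>
    also have "\<dots> = (lag_gamma \<alpha> (Suc n) * (a n * L (Suc n) - a (Suc n) * L n)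
        + ((x - c) * a (Suc n) - b (Suc n)) * L (Suc n)) / h (Suc n)"
      unfolding Suc hS using g h[of n] by (simp add: add_divide_distrib)
    also have "lag_gamma \<alpha> (Suc n) * (a n * L (Suc n) - a (Suc n) * L n)
        + ((x - c) * a (Suc n) - b (Suc n)) * L (Suc n)
        = a (Suc n) * L (Suc (Suc n)) - a (Suc (Suc n)) * L (Suc n)"
      unfolding A[of "Suc n"] L[of "Suc n"] by (simp add: algebra_simps)
    finally show ?case .
  qed
  then show "poly ([:- c, 1:] * lag_kernel \<alpha> (Suc n) c k) x = poly ((if k = 0 then 0 else lag_kernel \<alpha> (Suc n) c (k - 1))
             + smult (1 / lag_h \<alpha> n) (smult (taylor_coeff c k (lagp \<alpha> n)) (lagp \<alpha> (Suc n))
                 - smult (taylor_coeff c k (lagp \<alpha> (Suc n))) (lagp \<alpha> n))) x"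
    by (cases "k = 0") (simp_all add: lag_kernel_def poly_sum a_def b_def L_def h_def algebra_simps diff_divide_distrib
        del: lagp.simps(2) sum.lessThan_Suc)
qed

lemma taylor_poly_eq:
  "taylor_poly k c f = (\<Sum>\<nu>\<le>k. smult (taylor_coeff c \<nu> f) ([:- c, 1:] ^ \<nu>))"
  by (simp add: taylor_poly_def taylor_coeff_def)

text \<open>Iterating \<open>lag_kernel_step\<close> down to index 0, each step contributes one
  power of x - c with one Taylor coefficient; these contributions assemble into the Taylor
  polynomials appearing in \<open>F2\<close> and \<open>G2\<close>.\<close>

lemma christoffel_darboux_taylor:
  assumes "\<alpha> > - 1"
  shows "[:- c, 1:] ^ (k + 1) * lag_kernel \<alpha> (Suc n) c k
     = smult (1 / lag_h \<alpha> n) (taylor_poly k c (lagp \<alpha> n) * lagp \<alpha> (Suc n)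
         - taylor_poly k c (lagp \<alpha> (Suc n)) * lagp \<alpha> n)"
proof (induction k)
  case 0
  show ?case using lag_kernel_step[OF assms, of c n 0] by (simp add: taylor_poly_eq del: lagp.simps(2))
next
  case (Suc k)
  have "[:- c, 1:] ^ (Suc k + 1) * lag_kernel \<alpha> (Suc n) c (Suc k)
      = [:- c, 1:] ^ (k + 1) * ([:- c, 1:] * lag_kernel \<alpha> (Suc n) c (Suc k))"
    by (simp only: add_Suc power_Suc mult_ac)
  also have "\<dots> = [:- c, 1:] ^ (k + 1) * lag_kernel \<alpha> (Suc n) c k
     + [:- c, 1:] ^ (k + 1) * smult (1 / lag_h \<alpha> n)
        (smult (taylor_coeff c (Suc k) (lagp \<alpha> n)) (lagp \<alpha> (Suc n))
                 - smult (taylor_coeff c (Suc k) (lagp \<alpha> (Suc n))) (lagp \<alpha> n))"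
    unfolding lag_kernel_step[OF assms] by (simp add: algebra_simps del: lagp.simps(2))
  also have "\<dots> = smult (1 / lag_h \<alpha> n) (taylor_poly (Suc k) c (lagp \<alpha> n) * lagp \<alpha> (Suc n)
         - taylor_poly (Suc k) c (lagp \<alpha> (Suc n)) * lagp \<alpha> n)"
    unfolding Suc
    by (rule poly_ext) (simp add: taylor_poly_eq poly_sum algebra_simps del: lagp.simps(2))
  finally show ?case .
qed

lemma laguerre_ip_lagp_lagp:
  assumes "\<alpha> > - 1"
  shows "laguerre_ip \<alpha> (lagp \<alpha> i) (lagp \<alpha> m) = (if i = m then lag_h \<alpha> m else 0)"
proof -
  have less: "laguerre_ip \<alpha> (lagp \<alpha> i) (lagp \<alpha> m) = 0" if "m < i" for i m
    using that by (intro laguerre_ip_lagp_lower[OF assms]) (auto simp: coeff_eq_0)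
  consider "m < i" | "i < m" | "i = m" by linarith
  then show ?thesis
    using less[of m i] less[of i m] laguerre_ip_commute[of \<alpha> "lagp \<alpha> i" "lagp \<alpha> m"]
      laguerre_ip_lagp_top[OF assms, of "lagp \<alpha> m" m]
    by cases auto
qed

text \<open>The reproducing property of the kernel, taken at the \<open>k\<close>-th Taylor
  coefficient in y.\<close>

lemma laguerre_ip_kernel:
  assumes "\<alpha> > - 1" "m < n"
  shows "laguerre_ip \<alpha> (lag_kernel \<alpha> n c k) (lagp \<alpha> m) = taylor_coeff c k (lagp \<alpha> m)"
proof -
  interpret poly_form "laguerre_ip \<alpha>" by (rule poly_form_laguerre) fact
  have "laguerre_ip \<alpha> (lag_kernel \<alpha> n c k) (lagp \<alpha> m)
      = (\<Sum>i<n. if i = m then taylor_coeff c k (lagp \<alpha> m) else 0)"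
    unfolding lag_kernel_def ip_sum_left
    using lag_h_pos[OF assms(1), of m]
    by (intro sum.cong) (auto simp: ip_smult_left laguerre_ip_lagp_lagp[OF assms(1)])
  then show ?thesis using assms(2) by simp
qed

text \<open>A nonzero \<open>p\<close> paired with the Laguerre polynomial of its own degree gives
  its leading coefficient times a positive norm.\<close>

lemma eq_0_if_orth_lagp:
  assumes "\<alpha> > - 1" "\<forall>k\<ge>n. coeff p k = 0" "\<And>m. m < n \<Longrightarrow> laguerre_ip \<alpha> p (lagp \<alpha> m) = 0"
  shows "p = 0"
proof (rule ccontr)
  assume "p \<noteq> 0"
  then have "degree p < n"
    using assms(2) leading_coeff_neq_0 not_less by blast
  then have "laguerre_ip \<alpha> (lagp \<alpha> (degree p)) p = 0"
    using assms(3) laguerre_ip_commute by simp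
  moreover have "laguerre_ip \<alpha> (lagp \<alpha> (degree p)) p = lead_coeff p * lag_h \<alpha> (degree p)"
    by (intro laguerre_ip_lagp_top assms) simp
  ultimately show False
    using \<open>p \<noteq> 0\<close> lag_h_pos[OF assms(1), of "degree p"] by simp
qed

lemma coeff_lag_kernel:
  assumes "k \<ge> n"
  shows "coeff (lag_kernel \<alpha> n c \<nu>) k = 0"
  unfolding lag_kernel_def coeff_sum using assms
  by (intro sum.neutral) (auto simp: coeff_eq_0)

section \<open>Degrees and leading coefficients\<close>

text \<open>\<open>a = 0\<close> is allowed, so that lower-order terms can be carried along.\<close>

definition has_top :: "nat \<Rightarrow> 'a::comm_ring_1 \<Rightarrow> 'a poly \<Rightarrow> bool" where
  "has_top m a p \<longleftrightarrow> degree p \<le> m \<and> coeff p m = a"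

lemma has_top_mult:
  assumes "has_top m a p" "has_top k b q"
  shows "has_top (m + k) (a * b) (p * q)"
proof -
  have "coeff (p * q) (m + k) = (\<Sum>i\<le>m + k. if i = m then a * b else 0)"
    unfolding coeff_mult
  proof (rule sum.cong)
    fix i assume i: "i \<in> {..m + k}"
    consider "i < m" | "i > m" | "i = m" by linarith
    then show "coeff p i * coeff q (m + k - i) = (if i = m then a * b else 0)"
      using assms i by cases (auto simp: has_top_def coeff_eq_0)
  qed simp
  then show ?thesis
    using assms degree_mult_le[of p q] by (auto simp: has_top_def)
qed

lemma has_top_add: "has_top m a p \<Longrightarrow> has_top m b q \<Longrightarrow> has_top m (a + b) (p + q)"
  by (auto simp: has_top_def intro: degree_add_le)

lemma has_top_diff: "has_top m a p \<Longrightarrow> has_top m b q \<Longrightarrow> has_top m (a - b) (p - q)"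
  by (auto simp: has_top_def intro: degree_diff_le)

lemma has_top_uminus: "has_top m a p \<Longrightarrow> has_top m (- a) (- p)"
  by (auto simp: has_top_def)

lemma has_top_smult: "has_top m a p \<Longrightarrow> has_top m (b * a) (smult b p)"
  by (auto simp: has_top_def intro: order_trans[OF degree_smult_le])

lemma has_top_lift: "has_top k a p \<Longrightarrow> k < m \<Longrightarrow> has_top m 0 p"
  by (auto simp: has_top_def coeff_eq_0)

lemma has_top_0: "has_top m 0 0"
  by (simp add: has_top_def)

lemma has_top_sum:
  "(\<And>i. i \<in> A \<Longrightarrow> has_top m (a i) (p i)) \<Longrightarrow> has_top m (\<Sum>i\<in>A. a i) (\<Sum>i\<in>A. p i)"
  by (induction A rule: infinite_finite_induct) (auto intro: has_top_add has_top_0)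

lemma has_top_linear: "has_top 1 b [:a, b:]"
  by (simp add: has_top_def)

text \<open>The Euler operator x d/dx multiplies the coefficient of degree i by i.\<close>

lemma has_top_x_pderiv:
  fixes p :: "'a::idom poly"
  assumes "has_top m a p"
  shows "has_top m (of_nat m * a) ([:0, 1:] * pderiv p)"
proof -
  have "coeff ([:0, 1:] * pderiv p) i = of_nat i * coeff p i" for i
    by (cases i) (simp_all add: coeff_pderiv)
  note eq = this
  have "degree ([:0, 1:] * pderiv p) \<le> m"
    using assms by (intro degree_le) (auto simp only: eq has_top_def coeff_eq_0 mult_zero_right)
  then show ?thesis
    using assms eq[of m] by (simp only: has_top_def)
qed

text \<open>Transfers leading terms through exact division by a monic polynomial, as needed for
  \<open>rho_jk\<close> and \<open>delta\<close>.\<close>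

lemma has_top_cancel:
  fixes p q :: "'a::idom poly"
  assumes "has_top k 1 p" "has_top (k + m) a (p * q)"
  shows "has_top m a q"
proof (cases "q = 0")
  case False
  have "p \<noteq> 0" "degree p = k"
    using assms(1) le_degree[of p k] by (auto simp: has_top_def)
  then have "degree q \<le> m"
    using assms(2) False by (simp add: has_top_def degree_mult_eq)
  moreover from this have "has_top m (coeff q m) q" by (simp add: has_top_def)
  from has_top_mult[OF assms(1) this] have "coeff q m = a"
    using assms(2) by (simp add: has_top_def)
  ultimately show ?thesis by (simp add: has_top_def)
qed (use assms in \<open>simp add: has_top_def\<close>)

lemma has_top_DgCo: "has_top m a p \<Longrightarrow> a \<noteq> 0 \<Longrightarrow> DgCo p = (m, a)"
  using le_degree[of p m] by (auto simp: has_top_def DgCo_def)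

section \<open>Leading terms of \<open>rho\<close>, its quotients and Taylor polynomials\<close>

lemma has_top_linear_power: "has_top k 1 ([:a, 1:] ^ k :: 'a::idom poly)"
  using degree_linear_power[of a k] lead_coeff_power[of "[:a, 1:]" k]
  by (simp add: has_top_def)

lemma has_top_rho: "has_top (rho_deg N d) 1 (rho N c d)"
  unfolding rho_def rho_deg_def
proof (induction N)
  case (Suc N)
  then show ?case
    using has_top_mult[OF Suc has_top_linear_power[of "d (Suc N) + 1" "- c (Suc N)"]]
    by simp
qed (simp add: has_top_def)

lemma rho_nonzero: "rho N c d \<noteq> 0"
  using has_top_rho[of N d c] by (auto simp: has_top_def)

lemma rho_jk_mult:
  assumes "j \<in> {1..N}" "k \<le> d j"
  shows "[:- c j, 1:] ^ (k + 1) * rho_jk N c d j k = rho N c d"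
proof -
  have "[:- c j, 1:] ^ (k + 1) dvd [:- c j, 1:] ^ (d j + 1)"
    using assms by (intro le_imp_power_dvd) simp
  also have "\<dots> dvd rho N c d"
    unfolding rho_def using assms by (intro dvd_prodI) auto
  finally show ?thesis by (simp add: rho_jk_def)
qed

lemma has_top_rho_jk:
  assumes "j \<in> {1..N}" "k \<le> d j"
  shows "has_top (rho_deg N d - (k + 1)) 1 (rho_jk N c d j k)"
    and "k + 1 \<le> rho_deg N d"
proof -
  let ?p = "[:- c j, 1:] ^ (k + 1)" and ?r = "rho_jk N c d j k"
  have eq: "?p * ?r = rho N c d" using rho_jk_mult[where d = d, OF assms] .
  then have "degree ?p \<le> degree (rho N c d)"
    using rho_nonzero[of N c d] by (intro dvd_imp_degree_le) (metis dvd_triv_left)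
  also have "\<dots> \<le> rho_deg N d" using has_top_rho[of N d c] by (simp add: has_top_def)
  finally show le: "k + 1 \<le> rho_deg N d" by (simp only: degree_linear_power)
  have "has_top (k + 1 + (rho_deg N d - (k + 1))) 1 (?p * ?r)"
    unfolding eq le_add_diff_inverse[OF le] by (rule has_top_rho)
  then show "has_top (rho_deg N d - (k + 1)) 1 ?r"
    by (rule has_top_cancel[OF has_top_linear_power])
qed

lemma has_top_taylor_poly: "has_top k (taylor_coeff y k f) (taylor_poly k y f)"
proof -
  have "has_top k (\<Sum>\<nu>\<le>k. if \<nu> = k then taylor_coeff y k f else 0) (taylor_poly k y f)"
    unfolding taylor_poly_eq
  proof (rule has_top_sum)
    fix \<nu> assume "\<nu> \<in> {..k}"
    then show "has_top k (if \<nu> = k then taylor_coeff y k f else 0)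
        (smult (taylor_coeff y \<nu> f) ([:- y, 1:] ^ \<nu>))"
      using has_top_smult[OF has_top_linear_power[of \<nu> "- y"], of "taylor_coeff y \<nu> f"]
      by (auto intro: has_top_lift)
  qed
  then show ?thesis by simp
qed


section \<open>Laguerre-Sobolev polynomials\<close>

text \<open>Cramer's rule for \<open>l\<close>, \<open>m\<close> in the system \<open>Rs\<close>,
  \<open>Rt\<close> with determinant \<open>R * e\<close>; after cancelling \<open>R\<close>, the
  solution is inserted into \<open>D\<close>. Arbitrary ring elements are allowed, so both ladder
  equations are instances.\<close>

lemma ladder_identity:
  fixes R s t :: "'a::idom"
  assumes "R \<noteq> 0" and Rs: "R * s = F * l + G * m" and Rt: "R * t = V * l + W * m"
    and Re: "R * e = F * W - V * G" and D: "x * (R' * s + R * s') = H * l + K * m"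
  shows "(x * R' * e + K * V - H * W) * s + x * (F * W - V * G) * s' = (K * F - H * G) * t"
proof -
  have "R * (e * l) = (R * e) * l" by (simp add: mult_ac)
  also have "\<dots> = W * (F * l + G * m) - G * (V * l + W * m)"
    unfolding Re by (simp add: algebra_simps)
  also have "\<dots> = R * (W * s - G * t)"
    unfolding Rs[symmetric] Rt[symmetric] by (simp add: algebra_simps)
  finally have el: "e * l = W * s - G * t" using \<open>R \<noteq> 0\<close> by simp
  have "R * (e * m) = (R * e) * m" by (simp add: mult_ac)
  also have "\<dots> = F * (V * l + W * m) - V * (F * l + G * m)"
    unfolding Re by (simp add: algebra_simps)
  also have "\<dots> = R * (F * t - V * s)"
    unfolding Rs[symmetric] Rt[symmetric] by (simp add: algebra_simps)
  finally have em: "e * m = F * t - V * s" using \<open>R \<noteq> 0\<close> by simp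
  \<comment> \<open>Writing the determinant as \<open>R * e\<close> lets \<open>e\<close> be
    factored out of both derivative terms.\<close>
  have "(x * R' * e + K * V - H * W) * s + x * (R * e) * s'
      = e * (x * (R' * s + R * s')) + (K * V - H * W) * s"
    by (simp add: algebra_simps)
  also have "\<dots> = H * (e * l) + K * (e * m) + (K * V - H * W) * s"
    unfolding D by (simp add: algebra_simps)
  also have "\<dots> = (K * F - H * G) * t"
    unfolding el em by (simp add: algebra_simps)
  finally show ?thesis unfolding Re .
qed

lemma poly_inner_sobolev:
  assumes "\<alpha> > - 1"
  shows "poly_inner (sobolev_ip \<alpha> N c d lam)"
proof (unfold_locales, goal_cases)
  case (1 p q r)
  then show ?case
    by (simp add: sobolev_ip_def laguerre_ip_add_left[OF assms] higher_pderiv_add split_def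
        algebra_simps sum.distrib)
next
  case (2 a p r)
  then show ?case
    by (simp add: sobolev_ip_def laguerre_ip_smult_left higher_pderiv_smult split_def
        algebra_simps sum_distrib_left)
next
  case (3 p q)
  then show ?case
    by (simp add: sobolev_ip_def laguerre_ip_commute[of \<alpha> p q] mult_ac)
next
  case (4 p)
  have "(\<Sum>(j, k)\<in>Iplus N d lam.
          lam j k * poly ((pderiv ^^ k) p) (c j) * poly ((pderiv ^^ k) p) (c j)) \<ge> 0"
    by (intro sum_nonneg) (auto simp: Iplus_def mult.assoc)
  with laguerre_ip_pos[OF assms 4] show ?case by (simp add: sobolev_ip_def)
qed

section \<open>Connection between Sobolev and Laguerre polynomials\<close>

locale laguerre_sobolev =
  fixes \<alpha> :: real and N :: nat and c :: "nat \<Rightarrow> real" and d :: "nat \<Rightarrow> nat"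
    and lam :: "nat \<Rightarrow> nat \<Rightarrow> real"
  assumes alpha: "\<alpha> > - 1" and N: "N \<ge> 1"
begin

abbreviation "L \<equiv> lagp \<alpha>"
abbreviation "S \<equiv> sobolev_poly \<alpha> N c d lam"
abbreviation "J \<equiv> Iplus N d lam"
abbreviation "R \<equiv> rho N c d"
abbreviation "D \<equiv> rho_deg N d"
abbreviation "F \<equiv> F2 \<alpha> N c d lam"
abbreviation "G \<equiv> G2 \<alpha> N c d lam"
abbreviation "\<gamma> \<equiv> lag_gamma \<alpha>"
abbreviation "\<sigma> \<equiv> lag_sigma \<alpha> N c d lam"

text \<open>The factorial compensates the normalisation of \<open>taylor_coeff\<close>, so that the
  discrete part of the inner product with \<open>S n\<close> is a sum of \<open>mass\<close> times
  Taylor coefficients.\<close>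

definition mass :: "nat \<Rightarrow> nat \<Rightarrow> nat \<Rightarrow> real" where
  "mass n j k = fact k * lam j k * poly ((pderiv ^^ k) (S n)) (c j)"

sublocale sobolev: poly_inner "sobolev_ip \<alpha> N c d lam"
  by (rule poly_inner_sobolev) (rule alpha)

lemma degree_S: "degree (S n) = n"
  and coeff_S: "coeff (S n) n = 1"
  and S_orth: "\<forall>k\<ge>n. coeff q k = 0 \<Longrightarrow> sobolev_ip \<alpha> N c d lam (S n) q = 0"
  using sobolev.degree_monic_orth[of n] sobolev.lead_coeff_monic_orth[of n]
    sobolev.monic_orth_orth[of n q]
  by (simp_all add: sobolev_poly_def)

lemma higher_pderiv_eq_taylor_coeff: "poly ((pderiv ^^ k) p) y = fact k * taylor_coeff y k p"
  by (simp add: taylor_coeff_def)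

lemma sobolev_ip_S:
  "sobolev_ip \<alpha> N c d lam (S n) p
     = laguerre_ip \<alpha> (S n) p + (\<Sum>(j, k)\<in>J. mass n j k * taylor_coeff (c j) k p)"
  unfolding sobolev_ip_def mass_def higher_pderiv_eq_taylor_coeff[of _ p]
  by (simp add: mult_ac)

text \<open>The two sides differ by a polynomial of degree below \<open>n\<close>. Against each
  lower Laguerre polynomial, Sobolev orthogonality makes the integral of \<open>S n\<close> the
  negative of the discrete part, which the kernels reproduce.\<close>

lemma S_expansion:
  "S n = L n - (\<Sum>(j, k)\<in>J. smult (mass n j k) (lag_kernel \<alpha> n (c j) k))"
proof -
  interpret poly_form "laguerre_ip \<alpha>" by (rule poly_form_laguerre) (rule alpha)
  define T where "T = (\<Sum>(j, k)\<in>J. smult (mass n j k) (lag_kernel \<alpha> n (c j) k))"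
  have "S n - L n + T = 0"
  proof (rule eq_0_if_orth_lagp[OF alpha, of n])
    have "coeff T k = 0" if "k \<ge> n" for k
      unfolding T_def coeff_sum using that
      by (intro sum.neutral) (auto simp: coeff_lag_kernel)
    moreover have "coeff (S n - L n) k = 0" if "k \<ge> n" for k
      using that degree_S[of n] coeff_S[of n] by (cases "k = n") (auto simp: coeff_eq_0)
    ultimately show "\<forall>k\<ge>n. coeff (S n - L n + T) k = 0" by simp
  next
    fix m assume "m < n"
    then have "sobolev_ip \<alpha> N c d lam (S n) (L m) = 0"
      by (intro S_orth) (auto simp: coeff_eq_0)
    moreover have "laguerre_ip \<alpha> T (L m) = (\<Sum>(j, k)\<in>J. mass n j k * taylor_coeff (c j) k (L m))"
      unfolding T_def ip_sum_left using \<open>m < n\<close>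
      by (intro sum.cong) (auto simp: ip_smult_left laguerre_ip_kernel[OF alpha])
    moreover have "laguerre_ip \<alpha> (L n) (L m) = 0"
      using \<open>m < n\<close> by (simp add: laguerre_ip_lagp_lagp[OF alpha])
    ultimately show "laguerre_ip \<alpha> (S n - L n + T) (L m) = 0"
      by (simp add: ip_add_left ip_diff_left sobolev_ip_S)
  qed
  then show ?thesis by (simp add: T_def algebra_simps add_eq_0_iff)
qed

lemma F2_eq: "F n = R - (\<Sum>(j, k)\<in>J. smult (mass n j k / lag_h \<alpha> (n - 1))
    (taylor_poly k (c j) (L (n - 1)) * rho_jk N c d j k))"
  by (simp add: F2_def mass_def laguerre_eq_lagp[OF alpha])

lemma G2_eq: "G n = (\<Sum>(j, k)\<in>J. smult (mass n j k / lag_h \<alpha> (n - 1))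
    (taylor_poly k (c j) (L n) * rho_jk N c d j k))"
  by (simp add: G2_def mass_def laguerre_eq_lagp[OF alpha])

lemma sigma_eq: "\<sigma> n = (\<Sum>(j, k)\<in>J. mass n j k / lag_h \<alpha> (n - 1) * taylor_coeff (c j) k (L n))"
  unfolding lag_sigma_def mass_def laguerre_eq_lagp[OF alpha] higher_pderiv_eq_taylor_coeff[of _ "L n"]
  by (simp add: sum_distrib_left split_def mult_ac)

text \<open>Multiplying \<open>S_expansion\<close> by \<open>rho\<close> supplies the power of x -
  c_j required by \<open>christoffel_darboux_taylor\<close>; the cofactor is
  \<open>rho_jk\<close>.\<close>

lemma rho_mult_S:
  assumes "n \<ge> 1"
  shows "R * S n = F n * L n + G n * L (n - 1)"
proof -
  obtain m where n: "n = Suc m" using assms by (cases n) auto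
  let ?T = "\<lambda>j k i. taylor_poly k (c j) (L i)" and ?r = "rho_jk N c d"
  have K: "R * lag_kernel \<alpha> n (c j) k
      = smult (1 / lag_h \<alpha> m) (?T j k m * ?r j k * L n - ?T j k n * ?r j k * L m)"
    if "(j, k) \<in> J" for j k
  proof -
    have "[:- c j, 1:] ^ (k + 1) * ?r j k = R"
      using that by (intro rho_jk_mult) (auto simp: Iplus_def)
    then have "R * lag_kernel \<alpha> n (c j) k
        = ([:- c j, 1:] ^ (k + 1) * ?r j k) * lag_kernel \<alpha> n (c j) k" by (simp only:)
    also have "\<dots> = ?r j k * ([:- c j, 1:] ^ (k + 1) * lag_kernel \<alpha> n (c j) k)"
      by (simp only: mult_ac)
    also have "\<dots> = smult (1 / lag_h \<alpha> m) (?T j k m * ?r j k * L n - ?T j k n * ?r j k * L m)"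
      unfolding n christoffel_darboux_taylor[OF alpha]
      by (simp only: mult_smult_right right_diff_distrib mult_ac)
    finally show ?thesis .
  qed
  have "R * S n = R * L n - (\<Sum>(j, k)\<in>J. smult (mass n j k) (R * lag_kernel \<alpha> n (c j) k))"
    by (subst S_expansion) (simp add: right_diff_distrib sum_distrib_left split_def)
  also have "(\<Sum>(j, k)\<in>J. smult (mass n j k) (R * lag_kernel \<alpha> n (c j) k))
    = (\<Sum>(j, k)\<in>J. smult (mass n j k / lag_h \<alpha> m) (?T j k m * ?r j k) * L n
        - smult (mass n j k / lag_h \<alpha> m) (?T j k n * ?r j k) * L m)"
    by (intro sum.cong) (auto simp: K smult_diff_right)
  also have "\<dots> = (R - F n) * L n - G n * L m"
    unfolding F2_eq G2_eq
    by (simp add: split_def sum_subtractf sum_distrib_right n)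
  finally show ?thesis by (simp add: algebra_simps n del: lagp.simps(2))
qed

section \<open>Leading terms of \<open>F2\<close>, \<open>G2\<close>, \<open>F3\<close>,
  \<open>G3\<close> and the differentiated relation\<close>

lemma rho_deg_pos: "D \<ge> 1"
  using N by (cases N) (auto simp: rho_deg_def)

text \<open>The degrees \<open>k\<close> and \<open>D - (k + 1)\<close> add up to
  \<open>D - 1\<close> for every pair, so the leading coefficients can be summed; for
  \<open>G2\<close> the sum is \<sigma>.\<close>

lemma has_top_term:
  assumes "(j, k) \<in> J"
  shows "has_top (D - 1) (a * taylor_coeff (c j) k p) (smult a (taylor_poly k (c j) p * rho_jk N c d j k))"
proof -
  have jk: "j \<in> {1..N}" "k \<le> d j" using assms by (auto simp: Iplus_def)
  have "k + (D - (k + 1)) = D - 1" using has_top_rho_jk(2)[where d = d, OF jk] by simp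
  moreover have "has_top (k + (D - (k + 1))) (a * (taylor_coeff (c j) k p * 1))
      (smult a (taylor_poly k (c j) p * rho_jk N c d j k))"
    by (intro has_top_smult has_top_mult has_top_taylor_poly has_top_rho_jk(1) jk)
  ultimately show ?thesis by (simp only: mult_1_right)
qed

lemma has_top_term_sum:
  "has_top (D - 1) (\<Sum>(j, k)\<in>J. a j k * taylor_coeff (c j) k p)
     (\<Sum>(j, k)\<in>J. smult (a j k) (taylor_poly k (c j) p * rho_jk N c d j k))"
proof (rule has_top_sum)
  fix i assume "i \<in> J"
  moreover obtain j k where "i = (j, k)" by fastforce
  ultimately show "has_top (D - 1) (case i of (j, k) \<Rightarrow> a j k * taylor_coeff (c j) k p)
      (case i of (j, k) \<Rightarrow> smult (a j k) (taylor_poly k (c j) p * rho_jk N c d j k))"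
    by (simp only: prod.case has_top_term)
qed

lemma has_top_G2: "has_top (D - 1) (\<sigma> n) (G n)"
  unfolding G2_eq sigma_eq by (rule has_top_term_sum)

lemma has_top_F2: "has_top D 1 (F n)"
proof -
  have "has_top D (1 - 0) (F n)"
    unfolding F2_eq
    by (rule has_top_diff[OF has_top_rho has_top_lift[OF has_top_term_sum]])
      (use rho_deg_pos in simp)
  then show ?thesis by simp
qed

text \<open>As \<open>L n - S n\<close> has degree below \<open>n\<close>, the squared norm of
  \<open>S n\<close> equals its inner product with \<open>L n\<close>. The integral part is
  \<open>lag_h \<alpha> n\<close>, and the discrete part is
  \<open>lag_h \<alpha> (n - 1) * \<sigma> n\<close>.\<close>

lemma gamma_sigma_pos:
  assumes "n \<ge> 1"
  shows "\<gamma> n + \<sigma> n > 0"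
proof -
  obtain m where n: "n = Suc m" using assms by (cases n) auto
  have h: "lag_h \<alpha> m > 0" by (rule lag_h_pos) (rule alpha)
  have "sobolev_ip \<alpha> N c d lam (S n) (L n - S n) = 0"
  proof (rule S_orth, intro allI impI)
    fix k assume "k \<ge> n"
    then show "coeff (L n - S n) k = 0"
      using degree_S[of n] coeff_S[of n] by (cases "k = n") (auto simp: coeff_eq_0)
  qed
  then have "sobolev_ip \<alpha> N c d lam (S n) (L n) = sobolev_ip \<alpha> N c d lam (S n) (S n)"
    by (simp add: sobolev.ip_diff_right)
  moreover have "S n \<noteq> 0" using coeff_S[of n] by auto
  ultimately have "0 < sobolev_ip \<alpha> N c d lam (S n) (L n)"
    using sobolev.ip_pos by simp
  also have "\<dots> = lag_h \<alpha> n + lag_h \<alpha> m * \<sigma> n"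
    using laguerre_ip_lagp_top[OF alpha, of "S n" n] degree_S[of n] coeff_S[of n]
      laguerre_ip_commute[of \<alpha> "S n" "L n"] h
    by (simp add: sobolev_ip_S sigma_eq sum_distrib_left split_def n)
  also have "\<dots> = lag_h \<alpha> m * (\<gamma> n + \<sigma> n)"
    by (simp add: n lag_h_Suc[OF alpha] algebra_simps)
  finally show ?thesis using h by (simp add: zero_less_mult_iff)
qed

text \<open>Using the lowering formula for \<open>L n\<close> and the raising formula for
  \<open>L (n - 1)\<close> keeps everything in the span of these two; this explains the shape of
  \<open>F3\<close> and \<open>G3\<close>.\<close>

lemma x_pderiv_rho_S:
  assumes "n \<ge> 1"
  shows "[:0, 1:] * pderiv (R * S n) = F3 \<alpha> N c d lam n * L n + G3 \<alpha> N c d lam n * L (n - 1)"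
proof -
  obtain m where n: "n = Suc m" using assms by (cases n) auto
  have "[:0, 1:] * pderiv (R * S n) = [:0, 1:] * pderiv (F n) * L n + F n * ([:0, 1:] * pderiv (L n))
      + [:0, 1:] * pderiv (G n) * L m + G n * ([:0, 1:] * pderiv (L m))"
    using rho_mult_S[OF assms] by (simp only: n diff_Suc_1 pderiv_add pderiv_mult algebra_simps)
  also have "\<dots> = F3 \<alpha> N c d lam n * L n + G3 \<alpha> N c d lam n * L m"
    unfolding lagp_pderiv[of \<alpha> n] lagp_pderiv_Suc[of \<alpha> m] F3_def G3_def
    by (rule poly_ext) (simp add: n algebra_simps del: lagp.simps(2))
  finally show ?thesis by (simp add: n)
qed

lemma has_top_F3: "has_top D (real D + real n) (F3 \<alpha> N c d lam n)"
  using has_top_diff[OF has_top_add[OF has_top_x_pderiv[OF has_top_F2[of n]]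
        has_top_smult[OF has_top_F2[of n], of "real n"]] has_top_lift[OF has_top_G2[of n], of D]]
    rho_deg_pos
  by (simp add: F3_def del: mult_pCons_left)

text \<open>The x in n + \<alpha> - x lifts \<open>G2\<close> to degree \<open>D\<close> and
  contributes \<sigma>, while x times the derivative of \<open>G2\<close> stays below
  \<open>D\<close>.\<close>

lemma has_top_G3: "has_top D (\<gamma> n + \<sigma> n) (G3 \<alpha> N c d lam n)"
proof -
  have "has_top D 0 ([:0, 1:] * pderiv (G n))"
    using has_top_lift[OF has_top_x_pderiv[OF has_top_G2[of n]], of D] rho_deg_pos by simp
  moreover have "has_top D (- \<sigma> n) ([:real n + \<alpha>, - 1:] * G n)"
    using has_top_mult[OF has_top_linear[of "- 1" "real n + \<alpha>"] has_top_G2[of n]] rho_deg_pos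
    by (simp del: mult_pCons_left)
  moreover have "has_top D (\<gamma> n) (smult (\<gamma> n) (F n))"
    using has_top_smult[OF has_top_F2[of n], of "\<gamma> n"] by simp
  ultimately have "has_top D (0 + \<gamma> n - (- \<sigma> n)) (G3 \<alpha> N c d lam n)"
    unfolding G3_def by (intro has_top_diff has_top_add)
  then show ?thesis by simp
qed

text \<open>The recurrence solved for L_{n-2}, possible since \<gamma> is nonzero at
  \<open>n - 1\<close> for \<open>n \<ge> 2\<close>. It rewrites the relations for
  \<open>n - 1\<close> in the pair used for \<open>n\<close> and is the source of \<open>V2\<close>,
  \<open>W2\<close>, \<open>V3\<close>, \<open>W3\<close>.\<close>

lemma lagp_shift:
  assumes "n \<ge> 2"
  shows "p * L (n - 1) + q * L (n - 1 - 1)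
    = - smult (1 / \<gamma> (n - 1)) q * L n
      + (p + q * smult (1 / \<gamma> (n - 1)) [:- lag_beta \<alpha> (n - 1), 1:]) * L (n - 1)"
proof -
  obtain m where n: "n = Suc m" using assms by (cases n) auto
  have "\<gamma> m \<noteq> 0" using lag_gamma_pos[OF alpha, of m] assms n by simp
  then show ?thesis
    by (intro poly_ext) (simp add: n field_simps)
qed

end

section \<open>The ladder equations in polynomial form\<close>

locale laguerre_sobolev_ladder = laguerre_sobolev +
  fixes n :: nat
  assumes n: "n \<ge> 2"
begin

abbreviation "m \<equiv> n - 1"
abbreviation "F' \<equiv> F3 \<alpha> N c d lam n"
abbreviation "G' \<equiv> G3 \<alpha> N c d lam n"
abbreviation "V \<equiv> V2 \<alpha> N c d lam n"
abbreviation "W \<equiv> W2 \<alpha> N c d lam n"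
abbreviation "V' \<equiv> V3 \<alpha> N c d lam n"
abbreviation "W' \<equiv> W3 \<alpha> N c d lam n"
abbreviation "\<Delta> \<equiv> Delta \<alpha> N c d lam n"
abbreviation "\<delta> \<equiv> delta \<alpha> N c d lam n"
abbreviation "s \<equiv> \<sigma> m / \<gamma> m"

lemma gamma_pos: "\<gamma> m > 0"
  using n by (auto intro!: lag_gamma_pos alpha)

lemma one_plus_s_pos: "1 + s > 0"
  using gamma_sigma_pos[of m] gamma_pos n by (simp add: field_simps)

lemma rho_mult_S_n: "R * S n = F n * L n + G n * L m"
  using n by (intro rho_mult_S) simp

lemma rho_mult_S_pred: "R * S m = V * L n + W * L m"
proof -
  have "R * S m = F m * L m + G m * L (m - 1)"
    using n by (intro rho_mult_S) simp
  also have "\<dots> = V * L n + W * L m"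
    unfolding lagp_shift[OF n] V2_def W2_def ..
  finally show ?thesis .
qed

lemma x_pderiv_n: "[:0, 1:] * (pderiv R * S n + R * pderiv (S n)) = F' * L n + G' * L m"
proof -
  have "[:0, 1:] * (pderiv R * S n + R * pderiv (S n)) = [:0, 1:] * pderiv (R * S n)"
    by (simp only: pderiv_mult mult_ac add_ac)
  also have "\<dots> = F' * L n + G' * L m"
    using n by (intro x_pderiv_rho_S) simp
  finally show ?thesis .
qed

lemma x_pderiv_pred: "[:0, 1:] * (pderiv R * S m + R * pderiv (S m)) = V' * L n + W' * L m"
proof -
  have "[:0, 1:] * (pderiv R * S m + R * pderiv (S m)) = [:0, 1:] * pderiv (R * S m)"
    by (simp only: pderiv_mult mult_ac add_ac)
  also have "\<dots> = F3 \<alpha> N c d lam m * L m + G3 \<alpha> N c d lam m * L (m - 1)"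
    using n by (intro x_pderiv_rho_S) simp
  also have "\<dots> = V' * L n + W' * L m"
    unfolding lagp_shift[OF n] V3_def W3_def ..
  finally show ?thesis .
qed

text \<open>By Cramer's rule \<open>R\<close> divides the products of \<Delta> with
  \<open>L n\<close> and with \<open>L m\<close>; the Bezout identity combines these into \<Delta>
  itself.\<close>

lemma rho_mult_delta: "R * \<delta> = \<Delta>"
proof -
  obtain u v where uv: "u * L n + v * L m = 1"
    using lagp_bezout[OF alpha, of m] n by auto
  have "\<Delta> = u * (\<Delta> * L n) + v * (\<Delta> * L m)"
  proof -
    have "\<Delta> = \<Delta> * (u * L n + v * L m)" unfolding uv by simp
    then show ?thesis by (simp only: algebra_simps)
  qed
  also have "\<Delta> * L n = W * (F n * L n + G n * L m) - G n * (V * L n + W * L m)"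
    unfolding Delta_def by (simp only: algebra_simps)
  also have "\<dots> = R * (W * S n - G n * S m)"
    unfolding rho_mult_S_n[symmetric] rho_mult_S_pred[symmetric] by (simp only: algebra_simps)
  also have "\<Delta> * L m = F n * (V * L n + W * L m) - V * (F n * L n + G n * L m)"
    unfolding Delta_def by (simp only: algebra_simps)
  also have "\<dots> = R * (F n * S m - V * S n)"
    unfolding rho_mult_S_n[symmetric] rho_mult_S_pred[symmetric] by (simp only: algebra_simps)
  finally have "R dvd \<Delta>"
    by (metis dvd_add dvd_mult dvd_triv_left)
  then show ?thesis unfolding delta_def by simp
qed

lemma ladder_down:
  "q2 \<alpha> N c d lam n * S n + q0 \<alpha> N c d lam n * pderiv (S n) = q1 \<alpha> N c d lam n * S m"
  unfolding q0_def q1_def q2_def Delta_def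
  by (rule ladder_identity[OF rho_nonzero rho_mult_S_n rho_mult_S_pred _ x_pderiv_n])
    (simp only: rho_mult_delta Delta_def)

text \<open>The same identity with \<open>S n\<close>, \<open>S m\<close> exchanged and
  \<open>L n\<close>, \<open>L m\<close> exchanged. Swapping both rows and columns preserves the
  determinant, so \<open>q0\<close> and \<delta> are the same as in
  \<open>ladder_down\<close>.\<close>

lemma ladder_up:
  "q3 \<alpha> N c d lam n * S m + q0 \<alpha> N c d lam n * pderiv (S m) = q4 \<alpha> N c d lam n * S n"
proof -
  have "R * S m = W * L m + V * L n" "R * S n = G n * L m + F n * L n"
    "R * \<delta> = W * F n - G n * V"
    unfolding rho_mult_delta Delta_def
    by (simp_all only: rho_mult_S_n rho_mult_S_pred mult_ac add.commute)
  moreover have "[:0, 1:] * (pderiv R * S m + R * pderiv (S m)) = W' * L m + V' * L n"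
    using x_pderiv_pred by (simp only: add.commute)
  ultimately have "([:0, 1:] * pderiv R * \<delta> + V' * G n - W' * F n) * S m
      + [:0, 1:] * (W * F n - G n * V) * pderiv (S m) = (V' * W - W' * V) * S n"
    by (rule ladder_identity[OF rho_nonzero])
  then
  show ?thesis unfolding q0_def q3_def q4_def Delta_def by (simp only: mult_ac)
qed

section \<open>Degrees and leading coefficients in the ladder equations\<close>

lemma has_top_V: "has_top (D - 1) (- s) V"
  using has_top_uminus[OF has_top_smult[OF has_top_G2[of m], of "1 / \<gamma> m"]]
  by (simp add: V2_def)

lemma has_top_W: "has_top D (1 + s) W"
proof -
  have "has_top (D - 1 + 1) (\<sigma> m * (1 / \<gamma> m * 1))
      (G m * smult (1 / \<gamma> m) [:- lag_beta \<alpha> m, 1:])"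
    by (intro has_top_mult has_top_G2 has_top_smult has_top_linear)
  then have "has_top D s (G m * smult (1 / \<gamma> m) [:- lag_beta \<alpha> m, 1:])"
    using rho_deg_pos by simp
  then show ?thesis
    unfolding W2_def by (intro has_top_add has_top_F2)
qed

lemma has_top_V': "has_top D (- (1 + s)) V'"
proof -
  have "- (1 / \<gamma> m * (\<gamma> m + \<sigma> m)) = - (1 + s)"
    using gamma_pos by (simp add: field_simps)
  with has_top_uminus[OF has_top_smult[OF has_top_G3[of m], of "1 / \<gamma> m"]]
  show ?thesis by (simp only: V3_def)
qed

text \<open>\<open>F3\<close> has degree at most \<open>D\<close>, so the coefficient of degree
  \<open>D + 1\<close> comes from \<open>G3\<close> alone.\<close>

lemma has_top_W': "has_top (D + 1) (1 + s) W'"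
proof -
  have "has_top (D + 1) ((\<gamma> m + \<sigma> m) * (1 / \<gamma> m * 1))
      (G3 \<alpha> N c d lam m * smult (1 / \<gamma> m) [:- lag_beta \<alpha> m, 1:])"
    by (intro has_top_mult has_top_G3 has_top_smult has_top_linear)
  moreover have "has_top (D + 1) 0 (F3 \<alpha> N c d lam m)"
    by (rule has_top_lift[OF has_top_F3]) simp
  ultimately have "has_top (D + 1) (0 + (\<gamma> m + \<sigma> m) * (1 / \<gamma> m * 1)) W'"
    unfolding W3_def by (intro has_top_add)
  moreover have "0 + (\<gamma> m + \<sigma> m) * (1 / \<gamma> m * 1) = 1 + s"
    using gamma_pos by (simp add: field_simps)
  ultimately show ?thesis by (simp only:)
qed

lemma has_top_Delta: "has_top (D + D) (1 + s) \<Delta>"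
proof -
  have "has_top (D + D) 0 (V * G n)"
    using has_top_lift[OF has_top_mult[OF has_top_V has_top_G2[of n]], of "D + D"] rho_deg_pos by simp
  from has_top_diff[OF has_top_mult[OF has_top_F2[of n] has_top_W] this]
  show ?thesis by (simp add: Delta_def)
qed

lemma has_top_delta: "has_top D (1 + s) \<delta>"
  by (rule has_top_cancel[OF has_top_rho[of N d c]]) (simp only: rho_mult_delta has_top_Delta)

lemma has_top_x_pderiv_rho_delta: "has_top (D + D) (real D * (1 + s)) ([:0, 1:] * pderiv R * \<delta>)"
  using has_top_mult[OF has_top_x_pderiv[OF has_top_rho[of N d c]] has_top_delta] by simp

lemma DgCo_q0: "DgCo (q0 \<alpha> N c d lam n) = (2 * D + 1, 1 + s)"
proof (rule has_top_DgCo)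
  show "has_top (2 * D + 1) (1 + s) (q0 \<alpha> N c d lam n)"
    using has_top_mult[OF has_top_linear[of 1 0] has_top_Delta]
    by (simp add: q0_def mult_2 del: mult_pCons_left)
qed (use one_plus_s_pos in simp)

lemma DgCo_q1: "DgCo (q1 \<alpha> N c d lam n) = (2 * D, \<gamma> n + \<sigma> n)"
proof (rule has_top_DgCo)
  have "has_top (D + D) 0 (F' * G n)"
    using has_top_lift[OF has_top_mult[OF has_top_F3[of n] has_top_G2[of n]], of "D + D"] rho_deg_pos
    by simp
  from has_top_diff[OF has_top_mult[OF has_top_G3[of n] has_top_F2[of n]] this]
  show "has_top (2 * D) (\<gamma> n + \<sigma> n) (q1 \<alpha> N c d lam n)"
    by (simp add: q1_def mult_2)
qed (use gamma_sigma_pos[of n] n in simp)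

text \<open>The derivative of \<open>rho\<close> contributes \<open>D * (1 + s)\<close>, which
  cancels against the \<open>D\<close> in the leading coefficient \<open>D + n\<close> of
  \<open>F3\<close>.\<close>

lemma DgCo_q2: "DgCo (q2 \<alpha> N c d lam n) = (2 * D, - real n * (1 + s))"
proof (rule has_top_DgCo)
  have "has_top (D + D) 0 (G' * V)"
    using has_top_lift[OF has_top_mult[OF has_top_G3[of n] has_top_V], of "D + D"] rho_deg_pos
    by simp
  from has_top_diff[OF has_top_add[OF has_top_x_pderiv_rho_delta this]
      has_top_mult[OF has_top_F3[of n] has_top_W]]
  have "has_top (D + D) (real D * (1 + s) + 0 - (real D + real n) * (1 + s)) (q2 \<alpha> N c d lam n)"
    unfolding q2_def .
  moreover have "real D * (1 + s) + 0 - (real D + real n) * (1 + s) = - real n * (1 + s)"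
    by (simp only: algebra_simps)
  ultimately show "has_top (2 * D) (- real n * (1 + s)) (q2 \<alpha> N c d lam n)"
    by (simp only: mult_2)
qed (use one_plus_s_pos n in simp)

text \<open>Only \<open>W' * F n\<close> reaches degree \<open>2 * D + 1\<close>.\<close>

lemma DgCo_q3: "DgCo (q3 \<alpha> N c d lam n) = (2 * D + 1, - (1 + s))"
proof (rule has_top_DgCo)
  have "has_top (2 * D + 1) 0 ([:0, 1:] * pderiv R * \<delta>)"
    by (rule has_top_lift[OF has_top_x_pderiv_rho_delta]) simp
  moreover have "has_top (2 * D + 1) 0 (V' * G n)"
    by (rule has_top_lift[OF has_top_mult[OF has_top_V' has_top_G2[of n]]]) simp
  moreover have "has_top (2 * D + 1) (1 + s) (W' * F n)"
    using has_top_mult[OF has_top_W' has_top_F2[of n]] by (simp add: mult_2 add_ac)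
  ultimately have "has_top (2 * D + 1) (0 + 0 - (1 + s)) (q3 \<alpha> N c d lam n)"
    unfolding q3_def by (intro has_top_diff has_top_add)
  then show "has_top (2 * D + 1) (- (1 + s)) (q3 \<alpha> N c d lam n)" by simp
qed (use one_plus_s_pos in simp)

text \<open>Both products reach degree \<open>2 * D\<close>, as D + D and as (D + 1) + (D - 1); the
  quadratic terms in \<open>s\<close> cancel.\<close>

lemma DgCo_q4: "DgCo (q4 \<alpha> N c d lam n) = (2 * D, - (1 + s))"
proof (rule has_top_DgCo)
  have "has_top (2 * D) (- (1 + s) * (1 + s)) (V' * W)"
    using has_top_mult[OF has_top_V' has_top_W] by (simp only: mult_2)
  moreover have "has_top (2 * D) ((1 + s) * - s) (W' * V)"
    using has_top_mult[OF has_top_W' has_top_V] rho_deg_pos by (simp add: mult_2)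
  ultimately have "has_top (2 * D) (- (1 + s) * (1 + s) - (1 + s) * - s) (q4 \<alpha> N c d lam n)"
    unfolding q4_def by (rule has_top_diff)
  moreover have "- (1 + t) * (1 + t) - (1 + t) * - t = - (1 + t)" for t :: real
    by (simp add: algebra_simps)
  ultimately show "has_top (2 * D) (- (1 + s)) (q4 \<alpha> N c d lam n)" by (simp only:)
qed (use one_plus_s_pos in simp)

end

section \<open>Passage to rational functions\<close>

lemma ladder_fract:
  assumes "a * x + b * y = e * z" "e \<noteq> 0"
  shows "to_fract a / to_fract e * to_fract x + to_fract b / to_fract e * to_fract y = to_fract z"
proof -
  have "to_fract a * to_fract x + to_fract b * to_fract y = to_fract e * to_fract z"
    using assms(1) by (simp flip: to_fract_mult to_fract_add)
  moreover have "to_fract e \<noteq> 0" using assms(2) by simp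
  ultimately show ?thesis by (simp add: divide_simps)
qed

theorem theorem1:
  fixes \<alpha> :: real and N :: nat and c :: "nat \<Rightarrow> real" and d :: "nat \<Rightarrow> nat"
    and lam :: "nat \<Rightarrow> nat \<Rightarrow> real" and n :: nat
  assumes "\<alpha> > - 1" and "N \<ge> 1"
    and "\<And>j. j \<in> {1..N} \<Longrightarrow> c j < 0" and "inj_on c {1..N}"
    and "mono_on {1..N} d"
    and "\<And>j k. j \<in> {1..N} \<Longrightarrow> k \<le> d j \<Longrightarrow> lam j k \<ge> 0"
    and "\<And>j. j \<in> {1..N} \<Longrightarrow> lam j (d j) > 0"
    and "n \<ge> 2"
  shows
    "F4 \<alpha> N c d lam n * to_fract (sobolev_poly \<alpha> N c d lam n)
       + G4 \<alpha> N c d lam n * to_fract (pderiv (sobolev_poly \<alpha> N c d lam n))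
       = to_fract (sobolev_poly \<alpha> N c d lam (n - 1))
     \<and> V4 \<alpha> N c d lam n * to_fract (sobolev_poly \<alpha> N c d lam (n - 1))
       + W4 \<alpha> N c d lam n * to_fract (pderiv (sobolev_poly \<alpha> N c d lam (n - 1)))
       = to_fract (sobolev_poly \<alpha> N c d lam n)
     \<and> DgCo (q0 \<alpha> N c d lam n)
       = (2 * rho_deg N d + 1, 1 + lag_sigma \<alpha> N c d lam (n - 1) / lag_gamma \<alpha> (n - 1))
     \<and> DgCo (q1 \<alpha> N c d lam n)
       = (2 * rho_deg N d, lag_gamma \<alpha> n + lag_sigma \<alpha> N c d lam n)
     \<and> DgCo (q2 \<alpha> N c d lam n)
       = (2 * rho_deg N d,
          - real n * (1 + lag_sigma \<alpha> N c d lam (n - 1) / lag_gamma \<alpha> (n - 1)))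
     \<and> DgCo (q3 \<alpha> N c d lam n)
       = (2 * rho_deg N d + 1, - (1 + lag_sigma \<alpha> N c d lam (n - 1) / lag_gamma \<alpha> (n - 1)))
     \<and> DgCo (q4 \<alpha> N c d lam n)
       = (2 * rho_deg N d, - (1 + lag_sigma \<alpha> N c d lam (n - 1) / lag_gamma \<alpha> (n - 1)))"
proof -
  interpret laguerre_sobolev_ladder \<alpha> N c d lam n
    using assms by unfold_locales
  \<comment> \<open>The denominators are nonzero because their leading coefficients, \<gamma> +
    \<sigma> at \<open>n\<close> and \<open>- (1 + s)\<close>, are nonzero.\<close>
  have "q1 \<alpha> N c d lam n \<noteq> 0" "q4 \<alpha> N c d lam n \<noteq> 0"
    using DgCo_q1 DgCo_q4 one_plus_s_pos gamma_sigma_pos[of n] n by (auto simp: DgCo_def)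
  then show ?thesis
    unfolding F4_def G4_def V4_def W4_def
    by (intro conjI ladder_fract ladder_down ladder_up DgCo_q0 DgCo_q1 DgCo_q2 DgCo_q3 DgCo_q4)
qed

end
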